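(* For each $n\in\mathbb{N}$ (with $n\ge 1$), there exist an $n$-dimensional combinatorial cube $C_n\subset\mathbb{R}^n$ and $\mathbf{c}\in\mathbb{R}^n$ such that, for every regular norm $\eta$ on $\mathbb{R}^n$, the pivot rule \[\mathbf{v}^{i+1} = \operatorname*{arg\,max}_{\mathbf{u}\in N_{\mathbf{c}}(\mathbf{v}^i)} \frac{\mathbf{c}^{\intercal}(\mathbf{u}-\mathbf{v}^i)}{\eta(\mathbf{u}-\mathbf{v}^i)},\] where $N_{\mathbf{c}}(\mathbf{v}^i)$ is the set of $\mathbf{c}$-improving neighbors of $\mathbf{v}^i$, follows (from a suitable initial vertex) a path through all vertices of $C_n$ to maximize $\mathbf{c}^{\intercal}\mathbf{x}$ over $C_n$. (Here $C_n$ and $\mathbf{c}$ depend only on $n$, not on $\eta$.) In particular, on this linear program the $p$-steepest edge simplex method, i.e. the rule with $\eta=\|\cdot\|_p$, follows a path of exponential length (visiting all $2^n$ vertices) for all choices of $p\in[1,\infty]$.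
   Context: A norm $\eta:\mathbb{R}^n\to\mathbb{R}$ is called regular if $\eta(e_i)=1$ for all $i\in\{1,\dots,n\}$, where $e_1,\dots,e_n$ is the standard basis. An $n$-dimensional combinatorial cube is an $n$-dimensional polytope whose face lattice is isomorphic to that of $[0,1]^n$. For a vertex $\mathbf{v}$ of a polytope, a $\mathbf{c}$-improving neighbor is a vertex $\mathbf{u}$ joined to $\mathbf{v}$ by an edge of the polytope with $\mathbf{c}^{\intercal}\mathbf{u}>\mathbf{c}^{\intercal}\mathbf{v}$. Starting from an initial vertex $\mathbf{v}^0$, the pivot rule moves at each step from $\mathbf{v}^i$ to the neighbor $\mathbf{v}^{i+1}$ attaining the maximum, and stops when $N_{\mathbf{c}}(\mathbf{v}^i)=\emptyset$, i.e. at a maximizer of $\mathbf{c}^{\intercal}\mathbf{x}$. Lower bounds for a pivot rule are understood as allowing a choice of initial vertex; since $\mathbf{c}^{\intercal}\mathbf{x}$ increases along the path, a path through all vertices necessarily starts at the $\mathbf{c}$-minimal vertex. *)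

theory Defs
  imports "HOL-Analysis.Analysis"
begin

definition is_norm :: "(real ^ 'n \<Rightarrow> real) \<Rightarrow> bool" where
  "is_norm \<eta> \<longleftrightarrow>
     (\<forall>x. 0 \<le> \<eta> x) \<and>
     (\<forall>x. \<eta> x = 0 \<longleftrightarrow> x = 0) \<and>
     (\<forall>a x. \<eta> (a *\<^sub>R x) = \<bar>a\<bar> * \<eta> x) \<and>
     (\<forall>x y. \<eta> (x + y) \<le> \<eta> x + \<eta> y)"

definition regular_norm :: "(real ^ 'n \<Rightarrow> real) \<Rightarrow> bool" where
  "regular_norm \<eta> \<longleftrightarrow> is_norm \<eta> \<and> (\<forall>i. \<eta> (axis i 1) = 1)"

definition lp_norm :: "ereal \<Rightarrow> real ^ 'n \<Rightarrow> real" where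
  "lp_norm p x =
     (if p = \<infinity> then infnorm x
      else (\<Sum>i\<in>UNIV. \<bar>x $ i\<bar> powr real_of_ereal p) powr (1 / real_of_ereal p))"

text \<open>The face lattice of a polytope consists of all its faces, including the empty face and the
  polytope itself, ordered by inclusion. The set \<open>cbox 0 1\<close> is the standard cube.\<close>

definition face_lattice_isomorphic :: "(real ^ 'n) set \<Rightarrow> (real ^ 'm) set \<Rightarrow> bool" where
  "face_lattice_isomorphic P Q \<longleftrightarrow>
     (\<exists>f. bij_betw f {F. F face_of P} {G. G face_of Q} \<and>
          (\<forall>F F'. F face_of P \<longrightarrow> F' face_of P \<longrightarrow> (f F \<subseteq> f F' \<longleftrightarrow> F \<subseteq> F')))"

definition combinatorial_cube :: "(real ^ 'n) set \<Rightarrow> bool" where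
  "combinatorial_cube C \<longleftrightarrow>
     polytope C \<and> aff_dim C = int CARD('n) \<and>
     face_lattice_isomorphic C (cbox (0 :: real ^ 'n) 1)"

definition vertices :: "(real ^ 'n) set \<Rightarrow> (real ^ 'n) set" where
  "vertices P = {v. v extreme_point_of P}"

definition improving_neighbors ::
    "(real ^ 'n) set \<Rightarrow> real ^ 'n \<Rightarrow> real ^ 'n \<Rightarrow> (real ^ 'n) set" where
  "improving_neighbors P c v =
     {u \<in> vertices P. closed_segment v u edge_of P \<and> c \<bullet> u > c \<bullet> v}"

definition pivot_choices ::
    "(real ^ 'n \<Rightarrow> real) \<Rightarrow> (real ^ 'n) set \<Rightarrow> real ^ 'n \<Rightarrow> real ^ 'n \<Rightarrow> (real ^ 'n) set" where
  "pivot_choices \<eta> P c v =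
     {u. is_arg_max (\<lambda>u. (c \<bullet> (u - v)) / \<eta> (u - v)) (\<lambda>u. u \<in> improving_neighbors P c v) u}"

text \<open>A complete run of the pivot rule, listed from the initial to the final vertex. The equation
  \<open>v\<^sup>i\<^sup>+\<^sup>1 = argmax \<dots>\<close> is read as: the maximizer is unique and equals the next vertex, so
  the run does not rely on any tie-breaking.\<close>

definition pivot_run ::
    "(real ^ 'n \<Rightarrow> real) \<Rightarrow> (real ^ 'n) set \<Rightarrow> real ^ 'n \<Rightarrow> (real ^ 'n) list \<Rightarrow> bool" where
  "pivot_run \<eta> P c vs \<longleftrightarrow>
     vs \<noteq> [] \<and> hd vs \<in> vertices P \<and>
     (\<forall>i. Suc i < length vs \<longrightarrow> pivot_choices \<eta> P c (vs ! i) = {vs ! Suc i}) \<and>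
     improving_neighbors P c (last vs) = {}"

definition maximizing_run_through_all_vertices ::
    "(real ^ 'n \<Rightarrow> real) \<Rightarrow> (real ^ 'n) set \<Rightarrow> real ^ 'n \<Rightarrow> (real ^ 'n) list \<Rightarrow> bool" where
  "maximizing_run_through_all_vertices \<eta> P c vs \<longleftrightarrow>
     pivot_run \<eta> P c vs \<and> distinct vs \<and> set vs = vertices P \<and>
     (\<forall>x\<in>P. c \<bullet> x \<le> c \<bullet> last vs)"

end

(* Use coordinates a_k with a_0 = 0 and let the cube be a_(k-1) <= a_k <= 3^k - a_(k-1) for
   1 <= k <= n: each a_k lies on one of two facets at a vertex, so vertices are subsets B of {1..n}.
   Flipping k changes a_j, j >= k, by (-1)^|B Int {k..j}| D with a common D > 0. For the objective
   sum_k 2^k a_k the last summand decides the sign, so direction k is improving iff |B Int {k..n}| is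
   even. Per unit of a_n, the gain in direction k is S_k = sum_(j >= k) 2^j (-1)^|B Int {j+1..n}|,
   and for improving k < l the summand j = l-1 of S_k - S_l is positive and dominates the others, so
   S_k > S_l. The steepest rule in which a_n alone measures length thus flips the least improving
   index, which is exactly a step of the reflected Gray code.

   Placing a_k on the k-th axis with scale R^k for a huge R makes every edge direction nearly
   parallel to the last axis, where every regular norm is 1. Up to a relative error of order 1/R all
   regular norms therefore agree with |a_n| on the edges, and all of them follow the Gray code. *)

theory Submission
  imports Defs
begin

section \<open>Regular norms\<close>

text \<open>This extends the convexity of \<open>powr p\<close> on the positive reals to zero
  endpoints, where it reduces to \<open>m powr p \<le> m\<close> for a weight \<open>m\<close>
  between 0 and 1.\<close>

lemma powr_convex_combination_le:
  fixes p u v l :: real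
  assumes "1 \<le> p" "0 \<le> u" "0 \<le> v" "0 \<le> l" "l \<le> 1"
  shows "((1 - l) * u + l * v) powr p \<le> (1 - l) * u powr p + l * v powr p"
proof -
  have scale: "(m * w) powr p \<le> m * w powr p" if "0 \<le> m" "m \<le> 1" "0 \<le> w" for m w :: real
  proof -
    have "m powr p \<le> m powr 1"
      using that assms(1) powr_mono'[of 1 p m] by simp
    then show ?thesis
      using that by (simp add: powr_mult mult_right_mono)
  qed
  consider "u = 0" | "v = 0" | "0 < u" "0 < v"
    using assms by linarith
  then show ?thesis
  proof cases
    case 1
    then show ?thesis using scale[of l v] assms by simp
  next
    case 2
    then show ?thesis using scale[of "1 - l" u] assms by simp
  next
    case 3
    then show ?thesis
      using convex_onD[OF powr_convex[OF assms(1)], of l u v] assms by simp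
  qed
qed

text \<open>If both norms are positive, \<open>f\<close> and \<open>g\<close> are normalised to norm
  one, convexity is applied to each summand, and the weighted sums add up to 1. A vanishing norm
  rules out normalisation, but then that function is zero on \<open>I\<close>.\<close>

lemma Minkowski_powr:
  fixes f g :: "'a \<Rightarrow> real"
  assumes "finite I" "1 \<le> p"
  shows "(\<Sum>i\<in>I. \<bar>f i + g i\<bar> powr p) powr (1 / p)
    \<le> (\<Sum>i\<in>I. \<bar>f i\<bar> powr p) powr (1 / p) + (\<Sum>i\<in>I. \<bar>g i\<bar> powr p) powr (1 / p)"
proof -
  define N where "N h = (\<Sum>i\<in>I. \<bar>h i\<bar> powr p) powr (1 / p)" for h :: "'a \<Rightarrow> real"
  have N_powr: "N h powr p = (\<Sum>i\<in>I. \<bar>h i\<bar> powr p)" for h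
    using assms(2) by (simp add: N_def powr_powr sum_nonneg)
  have N_nonneg: "0 \<le> N h" for h
    by (simp add: N_def)
  have N_zero: "\<forall>i\<in>I. h i = 0" if "N h = 0" for h
    using N_powr[of h] that assms by (simp add: sum_nonneg_eq_0_iff)
  consider "N f = 0" | "N g = 0" | "0 < N f" "0 < N g"
    using N_nonneg[of f] N_nonneg[of g] by linarith
  then have "N (\<lambda>i. f i + g i) \<le> N f + N g"
  proof cases
    case 1
    have "(\<Sum>i\<in>I. \<bar>f i + g i\<bar> powr p) = (\<Sum>i\<in>I. \<bar>g i\<bar> powr p)"
      using N_zero[OF 1] by (intro sum.cong) auto
    then have "N (\<lambda>i. f i + g i) = N g"
      by (simp only: N_def)
    then show ?thesis using 1 by simp
  next
    case 2
    have "(\<Sum>i\<in>I. \<bar>f i + g i\<bar> powr p) = (\<Sum>i\<in>I. \<bar>f i\<bar> powr p)"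
      using N_zero[OF 2] by (intro sum.cong) auto
    then have "N (\<lambda>i. f i + g i) = N f"
      by (simp only: N_def)
    then show ?thesis using 2 by simp
  next
    case 3
    define s where "s = N f"
    define t where "t = N g"
    \<comment> \<open>With this weight the convex combination of the normalised values, times
      \<open>s + t\<close>, is again \<open>\<bar>f i\<bar> + \<bar>g i\<bar>\<close>.\<close>
    define l where "l = t / (s + t)"
    have st: "0 < s" "0 < t" using 3 by (auto simp: s_def t_def)
    have l: "0 \<le> l" "l \<le> 1" "1 - l = s / (s + t)"
      using st by (auto simp: l_def field_simps)
    have "\<bar>f i + g i\<bar> powr p
        \<le> (s + t) powr p * ((1 - l) * (\<bar>f i\<bar> powr p / s powr p) + l * (\<bar>g i\<bar> powr p / t powr p))" for i
    proof -
      have "(1 - l) * (\<bar>f i\<bar> / s) + l * (\<bar>g i\<bar> / t) = (\<bar>f i\<bar> + \<bar>g i\<bar>) / (s + t)"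
        using st unfolding l(3) unfolding l_def by (simp add: add_divide_distrib)
      then have eq: "(s + t) * ((1 - l) * (\<bar>f i\<bar> / s) + l * (\<bar>g i\<bar> / t)) = \<bar>f i\<bar> + \<bar>g i\<bar>"
        using st by simp
      have "\<bar>f i + g i\<bar> powr p \<le> (\<bar>f i\<bar> + \<bar>g i\<bar>) powr p"
        using assms by (intro powr_mono2) auto
      also have "\<dots> = (s + t) powr p * ((1 - l) * (\<bar>f i\<bar> / s) + l * (\<bar>g i\<bar> / t)) powr p"
        unfolding eq[symmetric] by (rule powr_mult)
      also have "\<dots> \<le> (s + t) powr p * ((1 - l) * (\<bar>f i\<bar> / s) powr p + l * (\<bar>g i\<bar> / t) powr p)"
        using st l assms by (intro mult_left_mono powr_convex_combination_le) auto
      finally show ?thesis using st by (simp add: powr_divide)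
    qed
    then have "(\<Sum>i\<in>I. \<bar>f i + g i\<bar> powr p)
        \<le> (\<Sum>i\<in>I. (s + t) powr p * ((1 - l) * (\<bar>f i\<bar> powr p / s powr p) + l * (\<bar>g i\<bar> powr p / t powr p)))"
      by (intro sum_mono) auto
    also have "\<dots> = (s + t) powr p * ((1 - l) * ((\<Sum>i\<in>I. \<bar>f i\<bar> powr p) / s powr p)
        + l * ((\<Sum>i\<in>I. \<bar>g i\<bar> powr p) / t powr p))"
      by (simp only: sum_distrib_left[symmetric] sum.distrib sum_divide_distrib[symmetric])
    also have "\<dots> = (s + t) powr p"
    proof -
      have "(\<Sum>i\<in>I. \<bar>f i\<bar> powr p) / s powr p = 1" "(\<Sum>i\<in>I. \<bar>g i\<bar> powr p) / t powr p = 1"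
        using st unfolding N_powr[symmetric] by (simp_all add: s_def t_def)
      then show ?thesis by (simp only:) simp
    qed
    finally have "N (\<lambda>i. f i + g i) \<le> ((s + t) powr p) powr (1 / p)"
      unfolding N_def using assms by (intro powr_mono2) (auto intro: sum_nonneg)
    also have "\<dots> = s + t"
      using st assms by (simp add: powr_powr)
    finally show ?thesis by (simp add: s_def t_def)
  qed
  then show ?thesis by (simp add: N_def)
qed

text \<open>This puts all p-steepest edge rules under the statement about regular norms. Minkowski's
  inequality is the only hard axiom, and \<open>p = \<infinity>\<close> is the separate branch with
  \<open>infnorm\<close>.\<close>

lemma regular_norm_lp_norm:
  assumes "1 \<le> p"
  shows "regular_norm (lp_norm p :: real ^ 'n \<Rightarrow> real)"
proof (cases "p = \<infinity>")
  case True
  have "infnorm (axis i 1 :: real ^ 'n) = 1" for i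
  proof -
    have "infnorm (axis i 1 :: real ^ 'n) \<le> 1"
      using infnorm_le_norm[of "axis i 1 :: real ^ 'n"] by simp
    moreover have "1 \<le> infnorm (axis i 1 :: real ^ 'n)"
      using Basis_le_infnorm[of "axis i 1" "axis i 1 :: real ^ 'n"]
      by (simp add: axis_in_Basis_iff inner_axis)
    ultimately show ?thesis by simp
  qed
  then show ?thesis
    unfolding regular_norm_def is_norm_def lp_norm_def using True
    by (simp add: infnorm_pos_le infnorm_eq_0 infnorm_mul infnorm_triangle)
next
  case False
  then obtain r where r: "p = ereal r" "1 \<le> r"
    using assms by (cases p) auto
  have lp: "lp_norm p x = (\<Sum>i\<in>UNIV. \<bar>x $ i\<bar> powr r) powr (1 / r)" for x :: "real ^ 'n"
    by (simp add: lp_norm_def r)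
  have zero: "lp_norm p x = 0 \<longleftrightarrow> x = 0" for x :: "real ^ 'n"
    unfolding lp using r(2) by (simp add: sum_nonneg_eq_0_iff vec_eq_iff)
  have scale: "lp_norm p (a *\<^sub>R x) = \<bar>a\<bar> * lp_norm p x" for a and x :: "real ^ 'n"
  proof -
    have "(\<Sum>i\<in>UNIV. \<bar>(a *\<^sub>R x) $ i\<bar> powr r) = \<bar>a\<bar> powr r * (\<Sum>i\<in>UNIV. \<bar>x $ i\<bar> powr r)"
      by (simp add: abs_mult powr_mult sum_distrib_left)
    then show ?thesis
      unfolding lp using r(2) by (simp add: powr_mult powr_powr sum_nonneg)
  qed
  have unit: "lp_norm p (axis i 1 :: real ^ 'n) = 1" for i
  proof -
    have "(\<Sum>j\<in>UNIV. \<bar>axis i 1 $ j :: real\<bar> powr r) = (\<Sum>j\<in>UNIV. if j = i then 1 else 0)"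
      using r by (intro sum.cong) (auto simp: axis_def)
    then show ?thesis by (simp add: lp)
  qed
  show ?thesis
    unfolding regular_norm_def is_norm_def
    using zero scale unit Minkowski_powr[OF finite_class.finite_UNIV r(2)] by (auto simp: lp)
qed

lemma is_norm_sum_le:
  assumes "is_norm \<eta>" "finite S"
  shows "\<eta> (\<Sum>j\<in>S. x j) \<le> (\<Sum>j\<in>S. \<eta> (x j))"
  using assms(2)
proof induction
  case empty
  have "\<eta> 0 = 0" using assms(1) unfolding is_norm_def by blast
  then show ?case by simp
next
  case (insert a S)
  have "\<eta> (x a + (\<Sum>j\<in>S. x j)) \<le> \<eta> (x a) + \<eta> (\<Sum>j\<in>S. x j)"
    using assms(1) unfolding is_norm_def by blast
  then show ?case using insert by simp
qed

lemma is_norm_abs_diff_le: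
  assumes "is_norm \<eta>"
  shows "\<bar>\<eta> (x + y) - \<eta> x\<bar> \<le> \<eta> y"
proof -
  have tri: "\<eta> (u + v) \<le> \<eta> u + \<eta> v" for u v
    using assms by (simp add: is_norm_def)
  have "\<eta> ((- 1) *\<^sub>R y) = \<bar>- 1\<bar> * \<eta> y"
    using assms unfolding is_norm_def by blast
  then show ?thesis using tri[of x y] tri[of "x + y" "(- 1) *\<^sub>R y"] by simp
qed

section \<open>Faces of polyhedra\<close>

text \<open>Each equation cuts out a face by a supporting hyperplane, and faces are closed under
  nonempty intersections. An empty \<open>J\<close> gives \<open>P\<close> itself.\<close>

lemma tight_constraints_face_of:
  fixes a :: "'i \<Rightarrow> 'v::euclidean_space"
  assumes P: "P = {x. \<forall>i\<in>I. a i \<bullet> x \<le> b i}" and "J \<subseteq> I"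
  shows "{x \<in> P. \<forall>i\<in>J. a i \<bullet> x = b i} face_of P"
proof -
  have "convex P"
  proof -
    have "P = (\<Inter>i\<in>I. {x. a i \<bullet> x \<le> b i})" using P by auto
    then show ?thesis by (auto intro: convex_INT convex_halfspace_le)
  qed
  show ?thesis
  proof (cases "J = {}")
    case True
    then show ?thesis using \<open>convex P\<close> by (simp add: face_of_refl)
  next
    case False
    have "(\<Inter>i\<in>J. P \<inter> {x. a i \<bullet> x = b i}) face_of P"
      using False assms \<open>convex P\<close>
      by (intro face_of_Inter) (auto intro!: face_of_Int_supporting_hyperplane_le)
    moreover have "(\<Inter>i\<in>J. P \<inter> {x. a i \<bullet> x = b i}) = {x \<in> P. \<forall>i\<in>J. a i \<bullet> x = b i}"
      using False by auto
    ultimately show ?thesis by simp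
  qed
qed

text \<open>The tight set of a relative interior point \<open>p\<close> of the face determines it: any point
  satisfying the same equations can be reflected through \<open>p\<close> a little way inside \<open>P\<close>.\<close>

lemma face_of_imp_tight_constraints:
  fixes a :: "'i \<Rightarrow> 'v::euclidean_space"
  assumes P: "P = {x. \<forall>i\<in>I. a i \<bullet> x \<le> b i}" and "finite I"
    and F: "F face_of P" "F \<noteq> {}"
  obtains J where "J \<subseteq> I" "F = {x \<in> P. \<forall>i\<in>J. a i \<bullet> x = b i}"
proof -
  have "rel_interior F \<noteq> {}"
    using F face_of_imp_convex rel_interior_eq_empty by blast
  then obtain p where p: "p \<in> rel_interior F" by blast
  then have pF: "p \<in> F" using rel_interior_subset by blast
  have FP: "F \<subseteq> P" using F face_of_imp_subset by blast
  define J where "J = {i \<in> I. a i \<bullet> p = b i}"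
  define G where "G = {x \<in> P. \<forall>i\<in>J. a i \<bullet> x = b i}"
  have "J \<subseteq> I" by (auto simp: J_def)
  have "F \<subseteq> G"
  \<comment> \<open>A face of \<open>P\<close> that meets the relative interior of a subset of
    \<open>P\<close> contains that subset; here the common point is \<open>p\<close>.\<close>
  proof (rule subset_of_face_of)
    show "G face_of P"
      unfolding G_def using P \<open>J \<subseteq> I\<close> by (rule tight_constraints_face_of)
    show "F \<subseteq> P" by (fact FP)
    show "G \<inter> rel_interior F \<noteq> {}"
      using p pF FP by (auto simp: G_def J_def)
  qed
  moreover have "G \<subseteq> F"
  proof
    fix x assume x: "x \<in> G"
    \<comment> \<open>Finitely many constraints are slack at \<open>p\<close>, so one small
      \<open>h\<close> keeps all of them slack. The tight ones stay equations for every
      \<open>h\<close>.\<close>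
    have "\<forall>\<^sub>F h in at_right 0. \<forall>i\<in>I - J. a i \<bullet> (p + h *\<^sub>R (p - x)) < b i"
    proof (intro eventually_ball_finite ballI)
      fix i assume i: "i \<in> I - J"
      have "((\<lambda>h::real. a i \<bullet> (p + h *\<^sub>R (p - x))) \<longlongrightarrow> a i \<bullet> (p + 0 *\<^sub>R (p - x))) (at_right 0)"
        by (intro tendsto_intros)
      moreover have "a i \<bullet> (p + 0 *\<^sub>R (p - x)) < b i"
        using i pF FP P by (force simp: J_def less_le)
      ultimately show "\<forall>\<^sub>F h in at_right 0. a i \<bullet> (p + h *\<^sub>R (p - x)) < b i"
        by (rule order_tendstoD)
    qed (use \<open>finite I\<close> in auto)
    then have "\<forall>\<^sub>F h in at_right 0. (0::real) < h \<and> (\<forall>i\<in>I - J. a i \<bullet> (p + h *\<^sub>R (p - x)) < b i)"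
      using eventually_at_right_less[of "0::real"] by eventually_elim auto
    then obtain h :: real where h: "0 < h" "\<forall>i\<in>I - J. a i \<bullet> (p + h *\<^sub>R (p - x)) < b i"
      using eventually_happens'[OF trivial_limit_at_right_real[of 0]] by blast
    define y where "y = p + h *\<^sub>R (p - x)"
    have "a i \<bullet> y \<le> b i" if "i \<in> I" for i
    proof (cases "i \<in> J")
      case True
      then show ?thesis
        using x pF by (simp add: y_def G_def J_def inner_add_right inner_diff_right)
    next
      case False
      then show ?thesis using h that by (simp add: y_def less_imp_le)
    qed
    then have y: "y \<in> P" using P by simp
    show "x \<in> F"
    proof (cases "x = p")
      case False
      have "p = (1 - 1 / (1 + h)) *\<^sub>R x + (1 / (1 + h)) *\<^sub>R y"
      proof -
        have "1 - 1 / (1 + h) = h / (1 + h)" using h(1) by (simp add: field_simps)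
        moreover have "(h / (1 + h)) *\<^sub>R x + (1 / (1 + h)) *\<^sub>R y
            = (1 / (1 + h)) *\<^sub>R (h *\<^sub>R x + y)"
          by (simp add: scaleR_right_distrib)
        moreover have "h *\<^sub>R x + y = (1 + h) *\<^sub>R p"
          by (simp add: y_def algebra_simps)
        ultimately show ?thesis using h(1) by simp
      qed
      moreover have "x \<noteq> y"
      proof
        assume "x = y"
        then have "(1 + h) *\<^sub>R (p - x) = 0" by (simp add: y_def algebra_simps)
        then show False using False h(1) by simp
      qed
      ultimately have "p \<in> open_segment x y"
        using h(1) unfolding in_segment by (intro conjI exI[of _ "1 / (1 + h)"]) auto
      then show ?thesis
        using F(1) x y pF by (auto simp: G_def dest: face_ofD)
    qed (use pF in simp)
  qed
  ultimately show thesis using that[OF \<open>J \<subseteq> I\<close>] by (simp add: G_def)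
qed

text \<open>The inconsistency of all equations together makes the empty face, too, a solution set of
  equations, namely for \<open>J = I\<close>.\<close>

lemma face_of_iff_tight_constraints:
  fixes a :: "'i \<Rightarrow> 'v::euclidean_space"
  assumes P: "P = {x. \<forall>i\<in>I. a i \<bullet> x \<le> b i}" and "finite I"
    and inconsistent: "{x \<in> P. \<forall>i\<in>I. a i \<bullet> x = b i} = {}"
  shows "F face_of P \<longleftrightarrow> (\<exists>J\<subseteq>I. F = {x \<in> P. \<forall>i\<in>J. a i \<bullet> x = b i})"
proof (cases "F = {}")
  case True
  then show ?thesis using inconsistent by auto
next
  case False
  show ?thesis
  proof
    assume "F face_of P"
    then show "\<exists>J\<subseteq>I. F = {x \<in> P. \<forall>i\<in>J. a i \<bullet> x = b i}"
      by (rule face_of_imp_tight_constraints[OF P \<open>finite I\<close> _ False]) blast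
  next
    assume "\<exists>J\<subseteq>I. F = {x \<in> P. \<forall>i\<in>J. a i \<bullet> x = b i}"
    then show "F face_of P" using tight_constraints_face_of[OF P] by auto
  qed
qed

section \<open>Gray codes\<close>

definition flip :: "nat \<Rightarrow> nat set \<Rightarrow> nat set" where
  "flip k B = (if k \<in> B then B - {k} else insert k B)"

lemma flip_neq [simp]: "flip k B \<noteq> B"
  by (auto simp: flip_def)

lemma mem_flip_iff: "j \<in> flip k B \<longleftrightarrow> (if j = k then k \<notin> B else j \<in> B)"
  by (auto simp: flip_def)

lemma even_card_insert_iff:
  assumes "finite A" "x \<notin> A"
  shows "even (card (insert x A)) \<longleftrightarrow> odd (card A)"
  using assms by simp

lemma odd_card_flip_Int_iff:
  assumes "j \<le> k" "k \<le> m"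
  shows "odd (card (flip k B \<inter> {j..m})) \<longleftrightarrow> even (card (B \<inter> {j..m}))"
proof (cases "k \<in> B")
  case True
  then have "B \<inter> {j..m} = insert k (flip k B \<inter> {j..m})"
    using assms by (auto simp: flip_def)
  then show ?thesis
    using even_card_insert_iff[of "flip k B \<inter> {j..m}" k] True by (simp add: mem_flip_iff)
next
  case False
  then have "flip k B \<inter> {j..m} = insert k (B \<inter> {j..m})"
    using assms by (auto simp: flip_def)
  then show ?thesis
    using even_card_insert_iff[of "B \<inter> {j..m}" k] False by simp
qed

text \<open>In a Gray code for the subsets of \<open>{1..n}\<close> the set \<open>B\<close> stands at the position with binary
  digits \<open>b\<^sub>k = card (B \<inter> {k..n}) mod 2\<close>, with \<open>b\<^sub>1\<close> least significant. Incrementing the position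
  flips \<open>B\<close> at the lowest \<open>k\<close> with \<open>b\<^sub>k = 0\<close>.\<close>

definition gray_step :: "nat \<Rightarrow> nat set \<Rightarrow> nat \<Rightarrow> bool" where
  "gray_step n B k \<longleftrightarrow> k \<in> {1..n} \<and> even (card (B \<inter> {k..n})) \<and>
     (\<forall>j\<in>{1..<k}. odd (card (B \<inter> {j..n})))"

text \<open>The reflected binary Gray code: the second half runs backwards, so the two halves meet
  in sets that differ only by \<open>Suc n\<close>.\<close>

primrec gray :: "nat \<Rightarrow> nat set list" where
  "gray 0 = [{}]"
| "gray (Suc n) = gray n @ map (insert (Suc n)) (rev (gray n))"

lemma length_gray: "length (gray n) = 2 ^ n"
  by (induction n) auto

lemma gray_neq_Nil [simp]: "gray n \<noteq> []"
  by (induction n) auto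

lemma set_gray: "set (gray n) = Pow {1..n}"
proof (induction n)
  case (Suc n)
  have "{1..Suc n} = insert (Suc n) {1..n}" by auto
  then show ?case using Suc by (simp add: Pow_insert)
qed simp

lemma distinct_gray: "distinct (gray n)"
proof (induction n)
  case (Suc n)
  have "inj_on (insert (Suc n)) (Pow {1..n})"
  proof (rule inj_onI)
    fix X Y assume "X \<in> Pow {1..n}" "Y \<in> Pow {1..n}" "insert (Suc n) X = insert (Suc n) Y"
    moreover from this have "Suc n \<notin> X" "Suc n \<notin> Y" by auto
    ultimately show "X = Y" by (simp add: insert_ident)
  qed
  then show ?case using Suc by (auto simp: distinct_map set_gray)
qed simp

lemma hd_gray: "hd (gray n) = {}"
  by (induction n) auto

lemma last_gray: "last (gray n) = (if n = 0 then {} else {n})"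
  by (cases n) (auto simp: last_map last_rev hd_gray)

lemma card_Int_atLeastAtMost_Suc:
  assumes "B \<subseteq> {1..n}" "j \<le> Suc n"
  shows "card (insert (Suc n) B \<inter> {j..Suc n}) = Suc (card (B \<inter> {j..n}))"
proof -
  have "insert (Suc n) B \<inter> {j..Suc n} = insert (Suc n) (B \<inter> {j..n})"
    using assms by auto
  then show ?thesis by simp
qed

text \<open>In the second half, adding \<open>Suc n\<close> changes the parity of every count, and
  so does the flip at \<open>k\<close> for the counts from \<open>j \<le> k\<close> on. The two
  changes cancel, so the step back from \<open>flip k B\<close> to \<open>B\<close> is again a step
  at \<open>k\<close>.\<close>

lemma gray_step_Suc:
  assumes "B \<subseteq> {1..n}" "gray_step n B k"
  shows "gray_step (Suc n) B k" "gray_step (Suc n) (insert (Suc n) (flip k B)) k"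
proof -
  have "B \<inter> {j..Suc n} = B \<inter> {j..n}" for j
    using assms(1) by auto
  then show "gray_step (Suc n) B k"
    using assms(2) by (auto simp: gray_step_def)
  have "flip k B \<subseteq> {1..n}"
    using assms by (auto simp: gray_step_def flip_def)
  then have parity: "even (card (insert (Suc n) (flip k B) \<inter> {j..Suc n}))
      \<longleftrightarrow> even (card (B \<inter> {j..n}))" if "j \<le> k" for j
    using that assms(2) odd_card_flip_Int_iff[of j k n B]
    by (subst card_Int_atLeastAtMost_Suc) (auto simp: gray_step_def)
  show "gray_step (Suc n) (insert (Suc n) (flip k B)) k"
    using assms(2) by (simp add: gray_step_def parity
        del: Int_insert_left Int_insert_left_if0 Int_insert_left_if1)
qed

lemma successively_gray:
  "successively (\<lambda>B B'. \<exists>k. gray_step n B k \<and> B' = flip k B) (gray n)"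
proof (induction n)
  case (Suc n)
  let ?Q = "\<lambda>n B B'. \<exists>k. gray_step n B k \<and> B' = flip k B"
  have "successively (?Q (Suc n)) (gray n)"
  proof (rule successively_mono[OF Suc])
    fix B B' assume "B \<in> set (gray n)" "?Q n B B'"
    then show "?Q (Suc n) B B'"
      using gray_step_Suc(1)[of B n] unfolding set_gray Pow_iff by blast
  qed
  \<comment> \<open>The arguments are swapped because the second half traverses
    \<open>gray n\<close> in reverse.\<close>
  moreover have "successively (\<lambda>B B'. ?Q (Suc n) (insert (Suc n) B') (insert (Suc n) B)) (gray n)"
  proof (rule successively_mono[OF Suc])
    fix B B' assume B: "B \<in> set (gray n)" and "?Q n B B'"
    then obtain k where k: "gray_step n B k" "B' = flip k B" by blast
    moreover have "flip k (insert (Suc n) B') = insert (Suc n) B"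
      using k B by (auto simp: mem_flip_iff gray_step_def set_gray split: if_splits)
    ultimately show "?Q (Suc n) (insert (Suc n) B') (insert (Suc n) B)"
      using gray_step_Suc(2)[of B n k] B by (intro exI[of _ k]) (simp add: set_gray)
  qed
  \<comment> \<open>At the junction the set is \<open>{n}\<close>, or empty for
    \<open>n = 0\<close>. All counts from \<open>j \<le> n\<close> on are 1, so the lowest even one
    belongs to \<open>Suc n\<close>.\<close>
  moreover have "?Q (Suc n) (last (gray n)) (insert (Suc n) (last (gray n)))"
    by (intro exI[of _ "Suc n"]) (auto simp: gray_step_def last_gray flip_def)
  ultimately show ?case
    by (simp add: successively_append_iff successively_map hd_map hd_rev)
qed simp

section \<open>The deformed cube\<close>

lemma sum_power2_atLeastLessThan:
  "k \<le> m \<Longrightarrow> (\<Sum>j=k..<m. 2 ^ j) = (2 ^ m - 2 ^ k :: real)"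
  by (induction m rule: dec_induct) auto

lemma abs_sum_power2_le:
  fixes s :: "nat \<Rightarrow> real"
  assumes "k \<le> m" "\<And>j. \<bar>s j\<bar> \<le> 1"
  shows "\<bar>\<Sum>j=k..<m. 2 ^ j * s j\<bar> \<le> 2 ^ m - 2 ^ k"
proof -
  have "\<bar>\<Sum>j=k..<m. 2 ^ j * s j\<bar> \<le> (\<Sum>j=k..<m. \<bar>2 ^ j * s j\<bar>)"
    by (rule sum_abs)
  also have "\<dots> \<le> (\<Sum>j=k..<m. 2 ^ j)"
    using assms(2) by (intro sum_mono) (simp add: abs_mult mult_left_le)
  finally show ?thesis using sum_power2_atLeastLessThan[OF assms(1)] by simp
qed

text \<open>With denominators cleared, the worst case is \<open>a * (1 + e) < b * (1 - e)\<close>, a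
  rearrangement of the last hypothesis. It lets a definite difference of slopes survive the relative
  error of the norm.\<close>

lemma dominated_ratio_less:
  fixes a b x y e :: real
  assumes "0 \<le> a" "0 \<le> b" "0 \<le> e" "e < 1" "\<bar>x - 1\<bar> \<le> e" "\<bar>y - 1\<bar> \<le> e" "(a + b) * e < b - a"
  shows "a / x < b / y"
proof -
  have xy: "1 - e \<le> x" "y \<le> 1 + e" "0 < x" "0 < y" using assms by auto
  have "a * y \<le> a * (1 + e)" using xy assms by (intro mult_left_mono) auto
  also have "\<dots> < b * (1 - e)" using assms(7) by (simp add: algebra_simps)
  also have "\<dots> \<le> b * x" using xy assms by (intro mult_left_mono) auto
  finally show ?thesis using xy by (simp add: field_simps)
qed

text \<open>The index type carries no order, so its axes are numbered by \<open>{1..n}\<close> to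
  allow recursion from one coordinate to the next.\<close>

locale enumerated_index =
  fixes e :: "nat \<Rightarrow> 'n::finite" and n :: nat
  assumes bij: "bij_betw e {1..n} UNIV"
begin

text \<open>Since \<open>R - 1 = 2 ^ (n + 2)\<close>, all lower axes together contribute at most the
  fraction \<open>1 / 2 ^ (n + 2)\<close> of the last one. This suffices for slopes of at most
  \<open>2 ^ Suc n\<close> that differ by at least 2.\<close>

definition R :: real where "R = 2 ^ (n + 2) + 1"

definition idx :: "'n \<Rightarrow> nat" where "idx = inv_into {1..n} e"

lemma idx_mem: "idx i \<in> {1..n}"
  unfolding idx_def using bij by (metis UNIV_I bij_betw_def inv_into_into)

lemma e_idx [simp]: "e (idx i) = i"
  unfolding idx_def using bij by (metis UNIV_I bij_betw_def f_inv_into_f)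

lemma idx_e [simp]: "k \<in> {1..n} \<Longrightarrow> idx (e k) = k"
  unfolding idx_def using bij by (simp add: bij_betw_def)

lemma idx_range: "1 \<le> idx i" "idx i \<le> n" "idx i \<noteq> 0"
  using idx_mem[of i] by auto

lemma n_pos: "1 \<le> n"
  using idx_mem by fastforce

lemma R_pos: "0 < R"
  by (simp add: R_def add_pos_pos)

text \<open>\<open>coord k \<bullet> x\<close> is the \<open>k\<close>-th cube coordinate \<open>a\<^sub>k\<close> of \<open>x\<close>, with \<open>a\<^sub>0 = 0\<close>; the corresponding axis is
  stretched by \<open>R\<^sup>k\<close>. The pair \<open>(k, b)\<close> indexes the lower (\<open>b = False\<close>) or upper facet in direction \<open>k\<close>.\<close>

definition coord :: "nat \<Rightarrow> real ^ 'n" where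
  "coord k = (if k = 0 then 0 else axis (e k) (1 / R ^ k))"

text \<open>The cube coordinates belonging to a parameter \<open>t\<close>: its entry at
  \<open>e k\<close> interpolates between the lower bound and the upper bound that the previous
  coordinate leaves for the \<open>k\<close>-th one.\<close>

primrec level :: "real ^ 'n \<Rightarrow> nat \<Rightarrow> real" where
  "level t 0 = 0"
| "level t (Suc k) = level t k + t $ e (Suc k) * (3 ^ Suc k - 2 * level t k)"

definition point :: "real ^ 'n \<Rightarrow> real ^ 'n" where
  "point t = (\<chi> i. R ^ idx i * level t (idx i))"

lemma coord_0 [simp]: "coord 0 = 0"
  by (simp add: coord_def)

lemma inner_coord: "k \<noteq> 0 \<Longrightarrow> coord k \<bullet> x = x $ e k / R ^ k"
  by (simp add: coord_def inner_axis')

lemma inner_coord_idx: "x $ i = R ^ idx i * (coord (idx i) \<bullet> x)"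
  using R_pos idx_range[of i] by (simp add: inner_coord)

lemma inner_coord_point [simp]: "k \<le> n \<Longrightarrow> coord k \<bullet> point t = level t k"
  using R_pos by (cases "k = 0") (simp_all add: inner_coord point_def)

lemma eqI_coord:
  assumes "\<And>k. k \<in> {1..n} \<Longrightarrow> coord k \<bullet> x = coord k \<bullet> y"
  shows "x = y"
  unfolding vec_eq_iff using assms[OF idx_mem] inner_coord_idx by metis

text \<open>As \<open>coord 0 = 0\<close>, direction 1 needs no special case: its two constraints
  bound the first coordinate by 0 and 3.\<close>

definition normal :: "nat \<times> bool \<Rightarrow> real ^ 'n" where
  "normal = (\<lambda>(k, b). if b then coord (k - 1) + coord k else coord (k - 1) - coord k)"

definition offset :: "nat \<times> bool \<Rightarrow> real" where
  "offset = (\<lambda>(k, b). if b then 3 ^ k else 0)"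

definition cube :: "(real ^ 'n) set" where
  "cube = {x. \<forall>i\<in>{1..n} \<times> UNIV. normal i \<bullet> x \<le> offset i}"

definition objective :: "real ^ 'n" where
  "objective = (\<Sum>k=1..n. 2 ^ k *\<^sub>R coord k)"

abbreviation unit_cube :: "(real ^ 'n) set" where "unit_cube \<equiv> cbox 0 1"

definition unit_normal :: "nat \<times> bool \<Rightarrow> real ^ 'n" where
  "unit_normal = (\<lambda>(k, b). if b then axis (e k) 1 else axis (e k) (- 1))"

definition unit_offset :: "nat \<times> bool \<Rightarrow> real" where
  "unit_offset = (\<lambda>(k, b). of_bool b)"

lemma all_index_iff: "(\<forall>i. P i) \<longleftrightarrow> (\<forall>k\<in>{1..n}. P (e k))"
  using e_idx idx_mem by metis

lemma unit_cube_iff: "t \<in> unit_cube \<longleftrightarrow> (\<forall>k\<in>{1..n}. 0 \<le> t $ e k \<and> t $ e k \<le> 1)"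
  by (auto simp: mem_box_cart all_index_iff)

lemma unit_cube_eq: "unit_cube = {x. \<forall>i\<in>{1..n} \<times> UNIV. unit_normal i \<bullet> x \<le> unit_offset i}"
  by (auto simp: unit_cube_iff unit_normal_def unit_offset_def inner_axis' split: if_splits)
    (metis (full_types) atLeastAtMost_iff)+

lemma unit_tight_iff: "unit_normal (k, b) \<bullet> t = unit_offset (k, b) \<longleftrightarrow> t $ e k = of_bool b"
  by (auto simp: unit_normal_def unit_offset_def inner_axis')

lemma mem_cube_iff:
  "x \<in> cube \<longleftrightarrow> (\<forall>k\<in>{1..n}. coord (k - 1) \<bullet> x \<le> coord k \<bullet> x \<and> coord k \<bullet> x \<le> 3 ^ k - coord (k - 1) \<bullet> x)"
  unfolding cube_def normal_def offset_def
  by (auto simp: inner_add_left inner_diff_left algebra_simps all_bool_eq split_paired_Ball_Sigma)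

section \<open>Parametrization of the deformed cube by the unit cube\<close>

lemma level_bounds:
  assumes "t \<in> unit_cube" "k \<le> n"
  shows "0 \<le> level t k \<and> level t k \<le> 3 ^ k"
  using assms(2)
proof (induction k)
  case (Suc k)
  let ?y = "level t k"
  have t: "0 \<le> t $ e (Suc k)" "t $ e (Suc k) \<le> 1"
    using assms(1) Suc.prems by (auto simp: unit_cube_iff)
  have y: "0 \<le> ?y" "?y \<le> 3 ^ k" using Suc by auto
  have "0 \<le> t $ e (Suc k) * (3 ^ Suc k - 2 * ?y)" using t y by (intro mult_nonneg_nonneg) auto
  moreover have "t $ e (Suc k) * (3 ^ Suc k - 2 * ?y) \<le> 1 * (3 ^ Suc k - 2 * ?y)"
    using t y by (intro mult_right_mono) auto
  ultimately show ?case using y by simp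
qed simp

text \<open>The length of the interval open to the \<open>k\<close>-th coordinate once the previous
  one is fixed. At vertices it is also the common \<open>D\<close> by which an edge in direction
  \<open>k\<close> changes the coordinates from \<open>k\<close> on.\<close>

definition gap :: "real ^ 'n \<Rightarrow> nat \<Rightarrow> real" where
  "gap t k = 3 ^ k - 2 * level t (k - 1)"

text \<open>Here base 3 matters: twice the largest previous coordinate is
  \<open>2 * 3 ^ (k - 1)\<close>, still below \<open>3 ^ k\<close>.\<close>

lemma gap_pos:
  assumes "t \<in> unit_cube" "k \<in> {1..n}"
  shows "0 < gap t k"
proof -
  have "level t (k - 1) \<le> 3 ^ (k - 1)" using level_bounds[of t "k - 1"] assms by auto
  moreover have "(3::real) ^ k = 3 * 3 ^ (k - 1)" using assms by (cases k) auto
  ultimately show ?thesis by (simp add: gap_def) (smt (verit) zero_less_power)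
qed

lemma level_gap: "k \<noteq> 0 \<Longrightarrow> level t k = level t (k - 1) + t $ e k * gap t k"
  by (cases k) (auto simp: gap_def)

lemma point_mem_cube:
  assumes "t \<in> unit_cube"
  shows "point t \<in> cube"
  unfolding mem_cube_iff
proof
  fix k assume k: "k \<in> {1..n}"
  then have t: "0 \<le> t $ e k" "t $ e k \<le> 1" using assms by (auto simp: unit_cube_iff)
  have "0 \<le> t $ e k * gap t k" "t $ e k * gap t k \<le> 1 * gap t k"
    using t gap_pos[OF assms k] by (auto intro: mult_right_mono)
  then show "coord (k - 1) \<bullet> point t \<le> coord k \<bullet> point t
      \<and> coord k \<bullet> point t \<le> 3 ^ k - coord (k - 1) \<bullet> point t"
    using k level_gap[of k t] by (auto simp: gap_def)
qed

text \<open>The slack of a constraint is the positive \<open>gap\<close> times the distance of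
  \<open>t $ e k\<close> from 0 or from 1. Hence corresponding facets of the two cubes are tight at
  the same parameters.\<close>

lemma tight_point_iff:
  assumes "t \<in> unit_cube" "k \<in> {1..n}"
  shows "normal (k, b) \<bullet> point t = offset (k, b) \<longleftrightarrow> t $ e k = of_bool b"
proof -
  have "normal (k, b) \<bullet> point t - offset (k, b)
      = (if b then (t $ e k - 1) * gap t k else - (t $ e k * gap t k))"
    using assms(2) level_gap[of k t]
    by (auto simp: normal_def offset_def inner_add_left inner_diff_left gap_def algebra_simps)
  then show ?thesis using gap_pos[OF assms] by (auto split: if_splits)
qed

lemma cube_coord_bounds:
  assumes "x \<in> cube" "k \<le> n"
  shows "0 \<le> coord k \<bullet> x \<and> coord k \<bullet> x \<le> 3 ^ k"
  using assms(2)
proof (induction k)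
  case (Suc k)
  then have "coord k \<bullet> x \<le> coord (Suc k) \<bullet> x \<and> coord (Suc k) \<bullet> x \<le> 3 ^ Suc k - coord k \<bullet> x"
    using assms(1) unfolding mem_cube_iff by
      (metis Suc_le_eq atLeastAtMost_iff diff_Suc_1 le_add1 plus_1_eq_Suc)
  then show ?case using Suc by auto
qed simp

lemma inj_on_point: "inj_on point unit_cube"
proof (rule inj_onI)
  fix t s assume t: "t \<in> unit_cube" and s: "s \<in> unit_cube" and eq: "point t = point s"
  have lev: "level t k = level s k" if "k \<le> n" for k
    using eq that inner_coord_point by metis
  have "t $ e k = s $ e k" if k: "k \<in> {1..n}" for k
  proof -
    have prev: "level t (k - 1) = level s (k - 1)" using k by (intro lev) auto
    then have "gap t k = gap s k" by (simp add: gap_def)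
    then have "t $ e k * gap t k = s $ e k * gap t k"
      using lev[of k] prev level_gap[of k t] level_gap[of k s] k by auto
    then show ?thesis using gap_pos[OF t k] by simp
  qed
  then show "t = s" by (simp add: vec_eq_iff all_index_iff)
qed

lemma bij_betw_point: "bij_betw point unit_cube cube"
proof -
  have "x \<in> point ` unit_cube" if x: "x \<in> cube" for x
  proof -
    \<comment> \<open>Here \<open>w k\<close> is the gap read off from \<open>x\<close>, and
      \<open>t\<close> records the relative position of each coordinate in its interval. This
      inverts \<open>point\<close>.\<close>
    define w where "w k = 3 ^ k - 2 * (coord (k - 1) \<bullet> x)" for k
    define t where "t = (\<chi> i. (coord (idx i) \<bullet> x - coord (idx i - 1) \<bullet> x) / w (idx i))"
    have w: "0 < w k" if "k \<in> {1..n}" for k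
    proof -
      have "coord (k - 1) \<bullet> x \<le> 3 ^ (k - 1)" using cube_coord_bounds[OF x, of "k - 1"] that by auto
      moreover have "(3::real) ^ k = 3 * 3 ^ (k - 1)" using that by (cases k) auto
      ultimately show ?thesis by (simp add: w_def) (smt (verit) zero_less_power)
    qed
    have t: "t $ e k = (coord k \<bullet> x - coord (k - 1) \<bullet> x) / w k" if "k \<in> {1..n}" for k
      using that by (simp add: t_def)
    have "level t k = coord k \<bullet> x" if "k \<le> n" for k
      using that
    proof (induction k)
      case (Suc k)
      then show ?case using t[of "Suc k"] w[of "Suc k"] by (simp add: w_def)
    qed simp
    then have "point t = x" by (intro eqI_coord) simp
    moreover have "t \<in> unit_cube"
      unfolding unit_cube_iff
    proof
      fix k assume k: "k \<in> {1..n}"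
      then have "coord (k - 1) \<bullet> x \<le> coord k \<bullet> x" "coord k \<bullet> x \<le> 3 ^ k - coord (k - 1) \<bullet> x"
        using x by (auto simp: mem_cube_iff)
      then show "0 \<le> t $ e k \<and> t $ e k \<le> 1"
        using w[OF k] by (auto simp: t[OF k] w_def divide_simps)
    qed
    ultimately show ?thesis by blast
  qed
  then show ?thesis using inj_on_point point_mem_cube by (auto simp: bij_betw_def)
qed

section \<open>The face lattice\<close>

definition unit_face :: "(nat \<times> bool) set \<Rightarrow> (real ^ 'n) set" where
  "unit_face J = {t \<in> unit_cube. \<forall>(k, b)\<in>J. t $ e k = of_bool b}"

lemma unit_face_subset: "unit_face J \<subseteq> unit_cube"
  by (auto simp: unit_face_def)

text \<open>The full index set demands both 0 and 1 at the first coordinate. This is the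
  inconsistency required for describing the faces of both cubes by equations.\<close>

lemma unit_face_all: "unit_face ({1..n} \<times> UNIV) = {}"
proof -
  have "t \<notin> unit_face ({1..n} \<times> UNIV)" for t
  proof
    assume "t \<in> unit_face ({1..n} \<times> UNIV)"
    then have "t $ e 1 = of_bool b" for b
      unfolding unit_face_def using n_pos by auto
    from this[of True] this[of False] show False by simp
  qed
  then show ?thesis by blast
qed

lemma tight_unit_cube_eq:
  "{t \<in> unit_cube. \<forall>i\<in>J. unit_normal i \<bullet> t = unit_offset i} = unit_face J"
  unfolding unit_face_def by (auto simp: unit_tight_iff)

lemma tight_cube_eq:
  assumes "J \<subseteq> {1..n} \<times> UNIV"
  shows "{x \<in> cube. \<forall>i\<in>J. normal i \<bullet> x = offset i} = point ` unit_face J"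
proof -
  have "(\<forall>i\<in>J. normal i \<bullet> point t = offset i) \<longleftrightarrow> (\<forall>(k, b)\<in>J. t $ e k = of_bool b)"
    if "t \<in> unit_cube" for t
  proof (rule ball_cong[OF refl])
    fix i assume "i \<in> J"
    then show "normal i \<bullet> point t = offset i \<longleftrightarrow> (case i of (k, b) \<Rightarrow> t $ e k = of_bool b)"
      using assms tight_point_iff[OF that] by (cases i) auto
  qed
  then have "unit_face J = {t \<in> unit_cube. \<forall>i\<in>J. normal i \<bullet> point t = offset i}"
    unfolding unit_face_def by (intro Collect_cong conj_cong) simp_all
  moreover have "cube = point ` unit_cube" using bij_betw_point by (simp only: bij_betw_def)
  ultimately show ?thesis by (simp only:) blast
qed

lemma face_of_unit_cube_iff:
  "F face_of unit_cube \<longleftrightarrow> (\<exists>J\<subseteq>{1..n} \<times> UNIV. F = unit_face J)"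
  using face_of_iff_tight_constraints[OF unit_cube_eq, of F]
  unfolding tight_unit_cube_eq unit_face_all by simp

lemma face_of_cube_iff:
  "F face_of cube \<longleftrightarrow> (\<exists>J\<subseteq>{1..n} \<times> UNIV. F = point ` unit_face J)"
proof -
  have "{x \<in> cube. \<forall>i\<in>{1..n} \<times> UNIV. normal i \<bullet> x = offset i} = {}"
    unfolding tight_cube_eq[OF subset_refl] unit_face_all by simp
  from face_of_iff_tight_constraints[OF cube_def _ this, of F]
  have "F face_of cube \<longleftrightarrow>
      (\<exists>J\<subseteq>{1..n} \<times> UNIV. F = {x \<in> cube. \<forall>i\<in>J. normal i \<bullet> x = offset i})"
    by simp
  also have "\<dots> \<longleftrightarrow> (\<exists>J\<subseteq>{1..n} \<times> UNIV. F = point ` unit_face J)"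
    by (intro ex_cong1 conj_cong refl) (simp only: tight_cube_eq)
  finally show ?thesis .
qed

text \<open>Both families of faces are indexed by the same sets \<open>J\<close>, so
  \<open>point\<close> carries faces to faces although it is not affine.\<close>

lemma face_of_cube_iff_image: "F face_of cube \<longleftrightarrow> (\<exists>K. K face_of unit_cube \<and> F = point ` K)"
  unfolding face_of_cube_iff face_of_unit_cube_iff by blast

lemma face_lattice_isomorphic_cube: "face_lattice_isomorphic cube unit_cube"
proof -
  \<comment> \<open>The preimage is restricted to the unit cube, where \<open>point\<close> is
    injective.\<close>
  define f where "f F = {t \<in> unit_cube. point t \<in> F}" for F
  have f_image: "f (point ` K) = K" if "K \<subseteq> unit_cube" for K
    using that inj_on_point by (auto simp: f_def dest: inj_onD)
  have image_f: "point ` f F = F" if "F \<subseteq> cube" for F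
    using that bij_betw_point by (force simp: f_def bij_betw_def)
  have "bij_betw f {F. F face_of cube} {G. G face_of unit_cube}"
  proof (rule bij_betw_byWitness[where f' = "image point"])
    show "\<forall>F\<in>{F. F face_of cube}. point ` f F = F"
      using image_f face_of_imp_subset by blast
    show "\<forall>G\<in>{G. G face_of unit_cube}. f (point ` G) = G"
      using f_image face_of_imp_subset by blast
    show "f ` {F. F face_of cube} \<subseteq> {G. G face_of unit_cube}"
    proof clarify
      fix F assume "F face_of cube"
      then obtain K where "K face_of unit_cube" "F = point ` K"
        unfolding face_of_cube_iff_image by blast
      then show "f F face_of unit_cube" using f_image[OF face_of_imp_subset] by simp
    qed
    show "image point ` {G. G face_of unit_cube} \<subseteq> {F. F face_of cube}"
      unfolding face_of_cube_iff_image by blast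
  qed
  moreover have "f F \<subseteq> f F' \<longleftrightarrow> F \<subseteq> F'" if "F face_of cube" "F' face_of cube" for F F'
  proof
    assume "f F \<subseteq> f F'"
    then have "point ` f F \<subseteq> point ` f F'" by (rule image_mono)
    then show "F \<subseteq> F'" using image_f that face_of_imp_subset by metis
  qed (auto simp: f_def)
  ultimately show ?thesis unfolding face_lattice_isomorphic_def by blast
qed

section \<open>Boundedness and full dimension\<close>

lemma polytope_cube: "polytope cube"
proof -
  have "cube = (\<Inter>i\<in>{1..n} \<times> UNIV. {x. normal i \<bullet> x \<le> offset i})"
    by (auto simp: cube_def)
  then have "polyhedron cube"
    by (auto intro!: polyhedron_Inter polyhedron_halfspace_le)
  moreover have "bounded cube"
  proof (rule bounded_subset)
    show "cube \<subseteq> cbox (\<chi> i. 0) (\<chi> i. R ^ idx i * 3 ^ idx i)"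
    proof
      fix x assume x: "x \<in> cube"
      have "0 \<le> x $ i \<and> x $ i \<le> R ^ idx i * 3 ^ idx i" for i
        using cube_coord_bounds[OF x idx_range(2)[of i]] R_pos
        by (simp add: inner_coord_idx[of x i])
      then show "x \<in> cbox (\<chi> i. 0) (\<chi> i. R ^ idx i * 3 ^ idx i)"
        by (simp add: mem_box_cart)
    qed
  qed simp
  ultimately show ?thesis by (simp add: polytope_eq_bounded_polyhedron)
qed

text \<open>The image of the centre of the unit cube satisfies all constraints strictly, so the
  interior is nonempty.\<close>

lemma aff_dim_cube: "aff_dim cube = int CARD('n)"
proof -
  define U where "U = (\<Inter>i\<in>{1..n} \<times> UNIV. {x. normal i \<bullet> x < offset i})"
  define t :: "real ^ 'n" where "t = (\<chi> i. 1 / 2)"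
  have t: "t \<in> unit_cube" by (simp add: unit_cube_iff t_def)
  have "normal (k, b) \<bullet> point t < offset (k, b)" if k: "k \<in> {1..n}" for k b
  proof -
    have "normal (k, b) \<bullet> point t \<le> offset (k, b)"
      using point_mem_cube[OF t] k unfolding cube_def by blast
    moreover have "normal (k, b) \<bullet> point t \<noteq> offset (k, b)"
      using tight_point_iff[OF t k] by (cases b) (auto simp: t_def)
    ultimately show ?thesis by simp
  qed
  then have "point t \<in> U" by (auto simp: U_def)
  moreover have "open U" unfolding U_def by (auto intro!: open_INT open_halfspace_lt)
  moreover have "U \<subseteq> cube" by (auto simp: U_def cube_def less_imp_le)
  ultimately have "interior cube \<noteq> {}" by (metis empty_iff interior_maximal subsetD)
  then show ?thesis by (simp add: aff_dim_nonempty_interior)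
qed

lemma combinatorial_cube_cube: "combinatorial_cube cube"
  by (simp add: combinatorial_cube_def polytope_cube aff_dim_cube face_lattice_isomorphic_cube)

section \<open>Vertices and edges\<close>

definition bits :: "nat set \<Rightarrow> real ^ 'n" where
  "bits B = (\<chi> i. of_bool (idx i \<in> B))"

definition vert :: "nat set \<Rightarrow> real ^ 'n" where
  "vert B = point (bits B)"

lemma bits_nth [simp]: "k \<in> {1..n} \<Longrightarrow> bits B $ e k = of_bool (k \<in> B)"
  by (simp add: bits_def)

lemma bits_mem_unit_cube: "bits B \<in> unit_cube"
  by (simp add: unit_cube_iff)

lemma bits_mem_unit_face_iff:
  assumes "J \<subseteq> {1..n} \<times> UNIV"
  shows "bits B \<in> unit_face J \<longleftrightarrow> (\<forall>(k, b)\<in>J. b \<longleftrightarrow> k \<in> B)"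
proof -
  have "bits B $ e k = of_bool b \<longleftrightarrow> (b \<longleftrightarrow> k \<in> B)" if "(k, b) \<in> J" for k b
    using that assms by (subst bits_nth) auto
  then show ?thesis unfolding unit_face_def using bits_mem_unit_cube by blast
qed

lemma bits_inject:
  assumes "B \<subseteq> {1..n}" "B' \<subseteq> {1..n}" "bits B = bits B'"
  shows "B = B'"
proof -
  have "k \<in> B \<longleftrightarrow> k \<in> B'" if "k \<in> {1..n}" for k
  proof -
    have "of_bool (k \<in> B) = (of_bool (k \<in> B') :: real)"
      using assms(3) bits_nth[OF that] by metis
    then show ?thesis by (simp only: of_bool_eq_iff)
  qed
  then show ?thesis using assms by blast
qed

lemma vert_inject:
  assumes "B \<subseteq> {1..n}" "B' \<subseteq> {1..n}"
  shows "vert B = vert B' \<longleftrightarrow> B = B'"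
  using bits_inject[OF assms] inj_onD[OF inj_on_point _ bits_mem_unit_cube bits_mem_unit_cube]
  by (auto simp: vert_def)

lemma vert_mem_cube: "vert B \<in> cube"
  by (simp add: vert_def point_mem_cube bits_mem_unit_cube)

lemma singleton_face_iff:
  assumes "t \<in> unit_cube"
  shows "{t} face_of unit_cube \<longleftrightarrow> (\<forall>k\<in>{1..n}. t $ e k \<in> {0, 1})"
proof
  assume "{t} face_of unit_cube"
  then obtain J where J: "J \<subseteq> {1..n} \<times> UNIV" "{t} = unit_face J"
    unfolding face_of_unit_cube_iff by blast
  show "\<forall>k\<in>{1..n}. t $ e k \<in> {0, 1}"
  proof (rule ccontr)
    assume "\<not> (\<forall>k\<in>{1..n}. t $ e k \<in> {0, 1})"
    then obtain k where k: "k \<in> {1..n}" "t $ e k \<noteq> 0" "t $ e k \<noteq> 1" by blast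
    \<comment> \<open>A fractional entry at \<open>k\<close> means that \<open>J\<close> does not
      constrain \<open>k\<close>, so the entry can be set to 0 without leaving the face.\<close>
    define s where "s = (\<chi> i. if i = e k then 0 else t $ i)"
    have tJ: "t \<in> unit_face J" using J by blast
    then have "s \<in> unit_cube" using assms by (auto simp: s_def unit_cube_iff)
    moreover have "s $ e j = of_bool b" if "(j, b) \<in> J" for j b
    proof -
      have "t $ e j = of_bool b" using tJ that unfolding unit_face_def by blast
      then show ?thesis using k by (cases b) (auto simp: s_def)
    qed
    ultimately have "s \<in> unit_face J" unfolding unit_face_def by blast
    then have "s = t" using J by blast
    moreover have "s $ e k = 0" by (simp add: s_def)
    ultimately show False using k by simp
  qed
next
  assume t: "\<forall>k\<in>{1..n}. t $ e k \<in> {0, 1}"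
  define J where "J = {(k, b). k \<in> {1..n} \<and> t $ e k = of_bool b}"
  have "unit_face J = {t}"
  proof
    show "unit_face J \<subseteq> {t}"
    proof
      fix s assume s: "s \<in> unit_face J"
      have "s $ e k = t $ e k" if k: "k \<in> {1..n}" for k
      proof -
        have "t $ e k = of_bool (t $ e k = 1)" using t k by force
        then have "(k, t $ e k = 1) \<in> J" using k by (simp add: J_def)
        then show ?thesis using s \<open>t $ e k = of_bool (t $ e k = 1)\<close>
          unfolding unit_face_def by auto
      qed
      then show "s \<in> {t}" by (simp add: vec_eq_iff all_index_iff)
    qed
    show "{t} \<subseteq> unit_face J" using assms by (auto simp: unit_face_def J_def)
  qed
  moreover have "J \<subseteq> {1..n} \<times> UNIV" by (auto simp: J_def)
  ultimately show "{t} face_of unit_cube" unfolding face_of_unit_cube_iff by metis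
qed

lemma vertices_cube: "vertices cube = vert ` Pow {1..n}"
proof
  show "vertices cube \<subseteq> vert ` Pow {1..n}"
  proof
    fix v assume "v \<in> vertices cube"
    then have "{v} face_of cube" by (simp add: vertices_def face_of_singleton)
    then obtain K where K: "K face_of unit_cube" "{v} = point ` K"
      unfolding face_of_cube_iff_image by blast
    then obtain t where t: "t \<in> K" "v = point t" by blast
    have tc: "t \<in> unit_cube" using t K face_of_imp_subset by blast
    have "K = {t}"
    proof -
      have "s = t" if "s \<in> K" for s
      proof (rule inj_onD[OF inj_on_point])
        show "point s = point t" using that K(2) t by blast
        show "s \<in> unit_cube" using that K face_of_imp_subset by blast
      qed (fact tc)
      then show ?thesis using t by blast
    qed
    then have t01: "\<forall>k\<in>{1..n}. t $ e k \<in> {0, 1}"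
      using K(1) singleton_face_iff[OF tc] by simp
    have "t = bits {k \<in> {1..n}. t $ e k = 1}"
      unfolding vec_eq_iff all_index_iff using t01 by auto
    then have "v = vert {k \<in> {1..n}. t $ e k = 1}" using t by (simp add: vert_def)
    then show "v \<in> vert ` Pow {1..n}" by blast
  qed
  show "vert ` Pow {1..n} \<subseteq> vertices cube"
  proof clarify
    fix B
    have "{bits B} face_of unit_cube"
      unfolding singleton_face_iff[OF bits_mem_unit_cube] by simp
    then have "{vert B} face_of cube"
      unfolding face_of_cube_iff_image vert_def by blast
    then show "vert B \<in> vertices cube" by (simp add: vertices_def face_of_singleton)
  qed
qed

text \<open>With its own parameter fixed, each recursion step is affine in the previous level, so
  varying only coordinate \<open>k\<close> gives an affine path. The second conjunct serves the step
  at \<open>k\<close> itself, where a varying parameter multiplies a level that must be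
  constant.\<close>

lemma level_affine:
  assumes k: "k \<in> {1..n}" and t: "t $ e k = 0" and u: "u $ e k = 1" and s: "s $ e k = c"
    and agree: "\<And>j. j \<in> {1..n} \<Longrightarrow> j \<noteq> k \<Longrightarrow> t $ e j = u $ e j \<and> s $ e j = u $ e j"
    and "j \<le> n"
  shows "level s j = (1 - c) * level t j + c * level u j
    \<and> (j < k \<longrightarrow> level s j = level u j \<and> level t j = level u j)"
  using \<open>j \<le> n\<close>
proof (induction j)
  case (Suc j)
  show ?case
  proof (cases "Suc j = k")
    case True
    show ?thesis
      using Suc t u s unfolding True[symmetric] by (simp add: algebra_simps)
  next
    case False
    then have eq: "t $ e (Suc j) = u $ e (Suc j)" "s $ e (Suc j) = u $ e (Suc j)"
      using agree Suc.prems by auto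
    have "level s j = (1 - c) * level t j + c * level u j"
      using Suc by simp
    then have "level s (Suc j) = ((1 - c) * level t j + c * level u j)
        + u $ e (Suc j) * (3 ^ Suc j - 2 * ((1 - c) * level t j + c * level u j))"
      by (simp only: level.simps eq)
    also have "\<dots> = (1 - c) * level t (Suc j) + c * level u (Suc j)"
      by (simp add: eq algebra_simps)
    finally have "level s (Suc j) = (1 - c) * level t (Suc j) + c * level u (Suc j)" .
    moreover have "Suc j < k \<longrightarrow> level s (Suc j) = level u (Suc j) \<and> level t (Suc j) = level u (Suc j)"
    proof
      assume "Suc j < k"
      then have "level s j = level u j" "level t j = level u j"
        using Suc.IH Suc.prems Suc_lessD Suc_leD by blast+
      then show "level s (Suc j) = level u (Suc j) \<and> level t (Suc j) = level u (Suc j)"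
        by (simp only: level.simps eq simp_thms)
    qed
    ultimately show ?thesis by blast
  qed
qed simp

lemma closed_segment_flip_face_of:
  assumes "k \<in> {1..n}"
  shows "closed_segment (vert (B - {k})) (vert (insert k B)) face_of cube"
proof -
  let ?t = "bits (B - {k})" and ?u = "bits (insert k B)"
  \<comment> \<open>Fixing all coordinates except \<open>k\<close> describes an edge of the unit
    cube, and \<open>point\<close> is affine along it.\<close>
  define J where "J = {(j, b). j \<in> {1..n} \<and> j \<noteq> k \<and> (b \<longleftrightarrow> j \<in> B)}"
  have point: "point s = (1 - c) *\<^sub>R vert (B - {k}) + c *\<^sub>R vert (insert k B)"
    if "s $ e k = c" "\<And>j. j \<in> {1..n} \<Longrightarrow> j \<noteq> k \<Longrightarrow> s $ e j = of_bool (j \<in> B)" for s c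
  proof (rule eqI_coord)
    fix j assume "j \<in> {1..n}"
    then show "coord j \<bullet> point s
        = coord j \<bullet> ((1 - c) *\<^sub>R vert (B - {k}) + c *\<^sub>R vert (insert k B))"
      using level_affine[of k ?t ?u s c j] that assms
      by (simp add: vert_def inner_add_right)
  qed
  have "point ` unit_face J = closed_segment (vert (B - {k})) (vert (insert k B))"
  proof
    show "point ` unit_face J \<subseteq> closed_segment (vert (B - {k})) (vert (insert k B))"
    proof clarify
      fix s assume s: "s \<in> unit_face J"
      have "s $ e j = of_bool (j \<in> B)" if "j \<in> {1..n}" "j \<noteq> k" for j
        using s that unfolding unit_face_def J_def by blast
      then have "point s = (1 - s $ e k) *\<^sub>R vert (B - {k}) + s $ e k *\<^sub>R vert (insert k B)"
        by (intro point) auto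
      moreover have "0 \<le> s $ e k" "s $ e k \<le> 1"
        using s assms unfolding unit_face_def unit_cube_iff by auto
      ultimately show "point s \<in> closed_segment (vert (B - {k})) (vert (insert k B))"
        unfolding in_segment by blast
    qed
    show "closed_segment (vert (B - {k})) (vert (insert k B)) \<subseteq> point ` unit_face J"
    proof
      fix x assume "x \<in> closed_segment (vert (B - {k})) (vert (insert k B))"
      then obtain c where c: "0 \<le> c" "c \<le> 1"
        "x = (1 - c) *\<^sub>R vert (B - {k}) + c *\<^sub>R vert (insert k B)"
        unfolding in_segment by blast
      define s :: "real ^ 'n" where "s = (\<chi> i. if i = e k then c else of_bool (idx i \<in> B))"
      have s: "s $ e k = c" "\<And>j. j \<in> {1..n} \<Longrightarrow> j \<noteq> k \<Longrightarrow> s $ e j = of_bool (j \<in> B)"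
      proof -
        fix j assume "j \<in> {1..n}" "j \<noteq> k"
        then have "e j \<noteq> e k" using assms idx_e by metis
        then show "s $ e j = of_bool (j \<in> B)" using \<open>j \<in> {1..n}\<close> by (simp add: s_def)
      qed (simp add: s_def)
      then have "x = point s" using c(3) point by simp
      moreover have "s \<in> unit_face J"
        unfolding unit_face_def unit_cube_iff J_def
        using s c by (auto simp: s_def)
      ultimately show "x \<in> point ` unit_face J" by blast
    qed
  qed
  moreover have "J \<subseteq> {1..n} \<times> UNIV" by (auto simp: J_def)
  ultimately show ?thesis unfolding face_of_cube_iff by metis
qed

lemma flip_subset: "B \<subseteq> {1..n} \<Longrightarrow> k \<in> {1..n} \<Longrightarrow> flip k B \<subseteq> {1..n}"
  by (auto simp: flip_def)

lemma edge_of_cube_flip: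
  assumes "B \<subseteq> {1..n}" "k \<in> {1..n}"
  shows "closed_segment (vert B) (vert (flip k B)) edge_of cube"
proof -
  have seg: "closed_segment (vert B) (vert (flip k B))
      = closed_segment (vert (B - {k})) (vert (insert k B))"
    using closed_segment_commute by (auto simp: flip_def insert_absorb)
  have "vert B \<noteq> vert (flip k B)"
    using vert_inject[OF assms(1) flip_subset[OF assms]] flip_neq by metis
  then have "aff_dim (closed_segment (vert B) (vert (flip k B))) = 1"
    by (simp add: segment_convex_hull aff_dim_convex_hull)
  then show ?thesis
    using closed_segment_flip_face_of[OF assms(2), of B] by (simp add: edge_of_def seg)
qed

text \<open>A face containing two vertices that differ at \<open>k\<close> has no constraint on coordinate \<open>k\<close>,
  so it contains the neighbour obtained by flipping \<open>k\<close> alone.\<close>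

lemma closed_segment_face_imp_flip:
  assumes B: "B \<subseteq> {1..n}" "B' \<subseteq> {1..n}" "B \<noteq> B'"
    and face: "closed_segment (vert B) (vert B') face_of cube"
  obtains k where "k \<in> {1..n}" "B' = flip k B"
proof -
  obtain J where J: "J \<subseteq> {1..n} \<times> UNIV"
    "closed_segment (vert B) (vert B') = point ` unit_face J"
    using face unfolding face_of_cube_iff by blast
  have mem: "bits A \<in> unit_face J" if "vert A \<in> closed_segment (vert B) (vert B')" for A
  proof -
    have "point (bits A) \<in> point ` unit_face J"
      using that unfolding J(2) by (simp only: vert_def)
    then show ?thesis
      using inj_on_image_mem_iff[OF inj_on_point bits_mem_unit_cube unit_face_subset] by blast
  qed
  have BJ: "(\<forall>(j, b)\<in>J. b \<longleftrightarrow> j \<in> B)" "(\<forall>(j, b)\<in>J. b \<longleftrightarrow> j \<in> B')"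
    using mem[of B] mem[of B'] bits_mem_unit_face_iff[OF J(1)] by auto
  obtain k where k: "k \<in> {1..n}" "k \<in> B \<longleftrightarrow> k \<notin> B'"
    using B by blast
  have "\<forall>(j, b)\<in>J. b \<longleftrightarrow> j \<in> flip k B"
  proof clarify
    fix j b assume "(j, b) \<in> J"
    then have "b \<longleftrightarrow> j \<in> B" "b \<longleftrightarrow> j \<in> B'" using BJ by blast+
    then show "b \<longleftrightarrow> j \<in> flip k B" using k by (auto simp: mem_flip_iff)
  qed
  then have "bits (flip k B) \<in> unit_face J"
    using bits_mem_unit_face_iff[OF J(1)] by blast
  then have "vert (flip k B) \<in> closed_segment (vert B) (vert B')"
    using J(2) unfolding vert_def by blast
  \<comment> \<open>A vertex of the cube on the segment must be an endpoint of it; as it is not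
    \<open>vert B\<close>, it is \<open>vert B'\<close>.\<close>
  moreover have "vert (flip k B) \<notin> open_segment (vert B) (vert B')"
  proof -
    have "vert (flip k B) extreme_point_of cube"
      using vertices_cube flip_subset[OF B(1) k(1)] unfolding vertices_def by blast
    then show ?thesis using vert_mem_cube unfolding extreme_point_of_def by blast
  qed
  ultimately have "vert (flip k B) = vert B \<or> vert (flip k B) = vert B'"
    unfolding open_segment_def by blast
  moreover have "vert (flip k B) \<noteq> vert B"
    using vert_inject[OF flip_subset[OF B(1) k(1)] B(1)] by simp
  ultimately have "vert (flip k B) = vert B'" by blast
  then have "B' = flip k B" using vert_inject[OF flip_subset[OF B(1) k(1)] B(2)] by simp
  then show thesis using that k(1) by blast
qed

section \<open>The pivot rule\<close>

lemma level_flip_below: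
  "j < k \<Longrightarrow> j \<le> n \<Longrightarrow> level (bits (flip k B)) j = level (bits B) j"
proof (induction j)
  case (Suc j)
  then have "bits (flip k B) $ e (Suc j) = bits B $ e (Suc j)"
    by (simp add: mem_flip_iff)
  then show ?case using Suc by simp
qed simp

text \<open>The edge leaving \<open>B\<close> in direction \<open>k\<close>, in the coordinates \<open>coord\<close>: passing an upper
  facet \<open>j\<close> reverses the sign, passing a lower facet keeps it.\<close>

lemma level_flip_diff:
  assumes "k \<in> {1..n}" "k \<le> j" "j \<le> n"
  shows "level (bits (flip k B)) j - level (bits B) j
    = (- 1) ^ card (B \<inter> {k..j}) * gap (bits B) k"
  using assms(2,3)
proof (induction j rule: dec_induct)
  case base
  have eq: "level (bits (flip k B)) (k - 1) = level (bits B) (k - 1)"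
    using assms by (intro level_flip_below) auto
  then have "level (bits (flip k B)) k - level (bits B) k
      = (of_bool (k \<notin> B) - of_bool (k \<in> B)) * gap (bits B) k"
    using assms(1) level_gap[of k "bits B"] level_gap[of k "bits (flip k B)"]
    by (simp add: gap_def mem_flip_iff algebra_simps)
  moreover have "B \<inter> {k..k} = (if k \<in> B then {k} else {})"
    by auto
  ultimately show ?case by simp
next
  case (step j)
  let ?d = "level (bits (flip k B)) j - level (bits B) j"
  have bit: "bits (flip k B) $ e (Suc j) = of_bool (Suc j \<in> B)" "bits B $ e (Suc j) = of_bool (Suc j \<in> B)"
    using step by (auto simp: mem_flip_iff)
  have IH: "?d = (- 1) ^ card (B \<inter> {k..j}) * gap (bits B) k"
    using step by simp
  have "level (bits (flip k B)) (Suc j) - level (bits B) (Suc j) = (if Suc j \<in> B then - ?d else ?d)"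
    by (simp add: bit algebra_simps)
  moreover have "B \<inter> {k..Suc j} = (if Suc j \<in> B then insert (Suc j) (B \<inter> {k..j}) else B \<inter> {k..j})"
    using step(1) by (auto simp: le_Suc_eq)
  ultimately show ?case unfolding IH by simp
qed

lemma coord_flip_diff:
  assumes "k \<in> {1..n}" "j \<le> n"
  shows "coord j \<bullet> (vert (flip k B) - vert B)
    = (if k \<le> j then (- 1) ^ card (B \<inter> {k..j}) * gap (bits B) k else 0)"
  using assms level_flip_diff[of k j B] level_flip_below[of j k B]
  by (simp add: vert_def inner_diff_right)

text \<open>The gain per unit of the last coordinate. Each sign compares the change of the
  \<open>j\<close>-th coordinate with that of the last one, so the top summand is always
  \<open>+ 2 ^ n\<close>.\<close>

definition slope :: "nat set \<Rightarrow> nat \<Rightarrow> real" where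
  "slope B k = (\<Sum>j=k..<Suc n. 2 ^ j * (- 1) ^ card (B \<inter> {Suc j..n}))"

lemma objective_flip_diff:
  assumes "k \<in> {1..n}"
  shows "objective \<bullet> (vert (flip k B) - vert B)
    = (- 1) ^ card (B \<inter> {k..n}) * gap (bits B) k * slope B k"
proof -
  \<comment> \<open>The elements above \<open>j\<close> are counted twice on the right and cancel.
    This factors the sign of the last coordinate out of the sum.\<close>
  have sign: "(- 1) ^ card (B \<inter> {k..j}) = ((- 1) ^ card (B \<inter> {k..n}) * (- 1) ^ card (B \<inter> {Suc j..n}) :: real)"
    if "j \<in> {k..n}" for j
  proof -
    have "B \<inter> {k..n} = (B \<inter> {k..j}) \<union> (B \<inter> {Suc j..n})" using that by auto
    moreover have "card \<dots> = card (B \<inter> {k..j}) + card (B \<inter> {Suc j..n})"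
      by (rule card_Un_disjoint) auto
    ultimately have "card (B \<inter> {k..n}) = card (B \<inter> {k..j}) + card (B \<inter> {Suc j..n})" by simp
    then show ?thesis by (simp add: power_add power_mult_distrib[symmetric] flip: mult.assoc)
  qed
  have "objective \<bullet> (vert (flip k B) - vert B)
      = (\<Sum>j=1..n. 2 ^ j * (coord j \<bullet> (vert (flip k B) - vert B)))"
    by (simp add: objective_def inner_sum_left)
  also have "\<dots> = (\<Sum>j=k..n. 2 ^ j * (coord j \<bullet> (vert (flip k B) - vert B)))"
    using assms by (intro sum.mono_neutral_right) (auto simp: coord_flip_diff)
  also have "\<dots> = (\<Sum>j=k..n. (- 1) ^ card (B \<inter> {k..n}) * gap (bits B) k
      * (2 ^ j * (- 1) ^ card (B \<inter> {Suc j..n})))"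
  proof (rule sum.cong[OF refl])
    fix j assume j: "j \<in> {k..n}"
    then have "coord j \<bullet> (vert (flip k B) - vert B) = (- 1) ^ card (B \<inter> {k..j}) * gap (bits B) k"
      using coord_flip_diff[OF assms, of j B] by simp
    then show "2 ^ j * (coord j \<bullet> (vert (flip k B) - vert B))
        = (- 1) ^ card (B \<inter> {k..n}) * gap (bits B) k * (2 ^ j * (- 1) ^ card (B \<inter> {Suc j..n}))"
      unfolding sign[OF j] by (simp only: mult_ac)
  qed
  also have "\<dots> = (- 1) ^ card (B \<inter> {k..n}) * gap (bits B) k * slope B k"
    by (simp only: sum_distrib_left[symmetric] slope_def atLeastLessThanSuc_atLeastAtMost)
  finally show ?thesis .
qed

text \<open>The top summand is \<open>2 ^ n\<close>, and the others amount to at most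
  \<open>2 ^ n - 2 ^ k\<close> in absolute value.\<close>

lemma slope_bounds:
  assumes "k \<in> {1..n}"
  shows "0 < slope B k" "slope B k \<le> 2 ^ Suc n"
proof -
  have "slope B k = (\<Sum>j=k..<n. 2 ^ j * (- 1) ^ card (B \<inter> {Suc j..n})) + 2 ^ n"
    using assms by (simp add: slope_def)
  moreover have "\<bar>\<Sum>j=k..<n. 2 ^ j * (- 1 :: real) ^ card (B \<inter> {Suc j..n})\<bar> \<le> 2 ^ n - 2 ^ k"
    using assms by (intro abs_sum_power2_le) (auto simp: power_abs)
  moreover have "(0::real) < 2 ^ k" by simp
  ultimately show "0 < slope B k" "slope B k \<le> 2 ^ Suc n"
    unfolding power_Suc by linarith+
qed

text \<open>The sign of the top summand \<open>2\<^sup>l\<^sup>-\<^sup>1\<close> of the difference is positive since direction \<open>l\<close> is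
  improving, and it dominates the rest.\<close>

lemma slope_diff_ge:
  assumes "k \<in> {1..n}" "l \<in> {1..n}" "k < l" "even (card (B \<inter> {l..n}))"
  shows "2 \<le> slope B k - slope B l"
proof -
  define m where "m = l - 1"
  have l: "l = Suc m" and km: "k \<le> m" using assms by (auto simp: m_def)
  have "slope B k = (\<Sum>j=k..<l. 2 ^ j * (- 1) ^ card (B \<inter> {Suc j..n})) + slope B l"
    unfolding slope_def using assms by (subst sum.atLeastLessThan_concat) auto
  also have "(\<Sum>j=k..<l. 2 ^ j * (- 1 :: real) ^ card (B \<inter> {Suc j..n}))
      = (\<Sum>j=k..<m. 2 ^ j * (- 1) ^ card (B \<inter> {Suc j..n})) + 2 ^ m"
    using km assms(4) by (simp add: l)
  finally have "slope B k - slope B l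
      = (\<Sum>j=k..<m. 2 ^ j * (- 1) ^ card (B \<inter> {Suc j..n})) + 2 ^ m" by simp
  moreover have "\<bar>\<Sum>j=k..<m. 2 ^ j * (- 1 :: real) ^ card (B \<inter> {Suc j..n})\<bar> \<le> 2 ^ m - 2 ^ k"
    using km by (intro abs_sum_power2_le) (auto simp: power_abs)
  \<comment> \<open>The difference is at least \<open>2 ^ k\<close>; the bound 2 comes from
    numbering directions from 1.\<close>
  moreover have "(2::real) ^ 1 \<le> 2 ^ k" using assms(1) by (intro power_increasing) auto
  ultimately show ?thesis by simp
qed

section \<open>Comparison of the edges under a regular norm\<close>

lemma sum_power_R_le: "(\<Sum>j=1..<n. R ^ j) \<le> R ^ n / 2 ^ (n + 2)"
proof -
  have "(R - 1) * (\<Sum>j=1..<m. R ^ j) \<le> R ^ m" for m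
  proof (induction m)
    case (Suc m)
    show ?case
    proof (cases "m = 0")
      case False
      then have "(R - 1) * (\<Sum>j=1..<Suc m. R ^ j) = (R - 1) * (\<Sum>j=1..<m. R ^ j) + (R - 1) * R ^ m"
        by (simp add: algebra_simps)
      also have "\<dots> \<le> R ^ m + (R - 1) * R ^ m" using Suc by simp
      also have "\<dots> = R ^ Suc m" by (simp add: algebra_simps)
      finally show ?thesis .
    qed (use R_pos in auto)
  qed simp
  from this[of n] show ?thesis
    by (simp add: R_def divide_simps mult.commute)
qed

text \<open>Every edge is almost parallel to the last axis, which is how \<open>\<eta>\<close> loses its influence.\<close>

lemma regular_norm_flip_diff:
  assumes "regular_norm \<eta>" and k: "k \<in> {1..n}"
  shows "\<bar>\<eta> (vert (flip k B) - vert B) / (R ^ n * gap (bits B) k) - 1\<bar> \<le> 1 / 2 ^ (n + 2)"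
proof -
  let ?d = "vert (flip k B) - vert B" and ?g = "gap (bits B) k"
  have g: "0 < ?g" using gap_pos[OF bits_mem_unit_cube k] .
  have \<eta>: "is_norm \<eta>" "\<eta> (axis i 1) = 1" for i
    using assms(1) by (auto simp: regular_norm_def)
  have \<eta>_axis: "\<eta> (a *\<^sub>R axis i (1::real)) = \<bar>a\<bar>" for a i
  proof -
    have "\<eta> (a *\<^sub>R axis i (1::real)) = \<bar>a\<bar> * \<eta> (axis i 1)"
      using \<eta>(1) unfolding is_norm_def by blast
    then show ?thesis by (simp add: \<eta>(2))
  qed
  have d_nth: "\<bar>?d $ i\<bar> = (if k \<le> idx i then R ^ idx i * ?g else 0)" for i
    using coord_flip_diff[OF k, of "idx i" B] idx_range[of i] g R_pos
    unfolding inner_coord_idx[of ?d i] by (auto simp: abs_mult power_abs)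
  have en: "idx (e n) = n" using n_pos by simp
  \<comment> \<open>On the component along the last axis, regularity gives the exact value of
    \<eta>. The remainder \<open>y\<close> is controlled by the triangle inequality and the
    geometric sum.\<close>
  define y where "y = (\<Sum>i\<in>UNIV - {e n}. ?d $ i *\<^sub>R axis i (1::real))"
  have "?d = (\<Sum>i\<in>UNIV. ?d $ i *\<^sub>R axis i (1::real))"
    using basis_expansion[of ?d] by (simp add: scalar_mult_eq_scaleR)
  also have "\<dots> = ?d $ e n *\<^sub>R axis (e n) (1::real) + y"
    unfolding y_def by (subst sum.remove[of _ "e n"]) auto
  finally have d: "?d = ?d $ e n *\<^sub>R axis (e n) (1::real) + y" .
  have "\<eta> y \<le> (\<Sum>i\<in>UNIV - {e n}. \<eta> (?d $ i *\<^sub>R axis i (1::real)))"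
    unfolding y_def by (intro is_norm_sum_le \<eta>) auto
  also have "\<dots> \<le> (\<Sum>i\<in>UNIV - {e n}. R ^ idx i * ?g)"
    unfolding \<eta>_axis d_nth using g R_pos by (intro sum_mono) auto
  also have "\<dots> = (\<Sum>j=1..<n. R ^ j * ?g)"
  proof (rule sum.reindex_bij_witness[where i = e and j = idx])
    fix i assume "i \<in> UNIV - {e n}"
    then have "e (idx i) \<noteq> e n" by simp
    then have "idx i \<noteq> n" by metis
    then show "idx i \<in> {1..<n}" using idx_range[of i] by auto
  next
    fix j assume "j \<in> {1..<n}"
    then have "idx (e j) \<noteq> idx (e n)" unfolding en by simp
    then show "e j \<in> UNIV - {e n}" by auto
  qed auto
  also have "\<dots> = (\<Sum>j=1..<n. R ^ j) * ?g"
    by (simp add: sum_distrib_right)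
  also have "\<dots> \<le> R ^ n / 2 ^ (n + 2) * ?g"
    using sum_power_R_le g by (intro mult_right_mono) auto
  finally have y: "\<eta> y \<le> R ^ n / 2 ^ (n + 2) * ?g" .
  have "\<eta> (?d $ e n *\<^sub>R axis (e n) (1::real)) = R ^ n * ?g"
    unfolding \<eta>_axis d_nth using k en by auto
  then have "\<bar>\<eta> ?d - R ^ n * ?g\<bar> \<le> \<eta> y"
    using is_norm_abs_diff_le[OF \<eta>(1), of "?d $ e n *\<^sub>R axis (e n) (1::real)" y] unfolding d[symmetric] by simp
  also note y
  finally have "\<bar>\<eta> ?d - R ^ n * ?g\<bar> \<le> 1 / 2 ^ (n + 2) * (R ^ n * ?g)"
    by simp
  moreover have Rg: "0 < R ^ n * ?g"
    using g R_pos by simp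
  moreover have "\<eta> ?d / (R ^ n * ?g) - 1 = (\<eta> ?d - R ^ n * ?g) / (R ^ n * ?g)"
    using g R_pos by (simp add: diff_divide_distrib)
  ultimately show ?thesis
    by (simp only: abs_divide abs_of_pos pos_divide_le_eq)
qed

text \<open>Gain and norm both scale with the gap, which cancels and leaves \<open>slope\<close>
  over a normalised norm \<open>h\<close> close to 1. The error in \<open>h\<close> costs at most 1,
  while the slopes differ by at least 2.\<close>

lemma pivot_ratio_less:
  assumes \<eta>: "regular_norm \<eta>" and k: "k \<in> {1..n}" and l: "l \<in> {1..n}" and "k < l"
    and even: "even (card (B \<inter> {k..n}))" "even (card (B \<inter> {l..n}))"
  shows "objective \<bullet> (vert (flip l B) - vert B) / \<eta> (vert (flip l B) - vert B)
    < objective \<bullet> (vert (flip k B) - vert B) / \<eta> (vert (flip k B) - vert B)"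
proof -
  define h where "h j = \<eta> (vert (flip j B) - vert B) / (R ^ n * gap (bits B) j)" for j
  have ratio: "objective \<bullet> (vert (flip j B) - vert B) / \<eta> (vert (flip j B) - vert B)
      = (slope B j / h j) / R ^ n"
    if "j \<in> {1..n}" "even (card (B \<inter> {j..n}))" for j
    using gap_pos[OF bits_mem_unit_cube that(1), of B] R_pos objective_flip_diff[OF that(1), of B] that(2)
    by (simp add: h_def)
  have "slope B l / h l < slope B k / h k"
  proof (rule dominated_ratio_less)
    show "\<bar>h l - 1\<bar> \<le> 1 / 2 ^ (n + 2)" "\<bar>h k - 1\<bar> \<le> 1 / 2 ^ (n + 2)"
      unfolding h_def using regular_norm_flip_diff[OF \<eta>] k l by blast+
    have "(slope B l + slope B k) * (1 / 2 ^ (n + 2)) \<le> (2 ^ Suc n + 2 ^ Suc n) * (1 / 2 ^ (n + 2))"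
      using slope_bounds[OF k, of B] slope_bounds[OF l, of B] by (intro mult_right_mono add_mono) auto
    also have "\<dots> = 1" by simp
    also have "1 < slope B k - slope B l" using slope_diff_ge[OF k l \<open>k < l\<close> even(2)] by simp
    finally show "(slope B l + slope B k) * (1 / 2 ^ (n + 2)) < slope B k - slope B l" .
    have "(2::real) ^ 0 < 2 ^ (n + 2)" by (intro power_strict_increasing) auto
    then show "1 / 2 ^ (n + 2) < (1::real)" by simp
  qed (use slope_bounds[OF k, of B] slope_bounds[OF l, of B] in auto)
  then show ?thesis
    unfolding ratio[OF k even(1)] ratio[OF l even(2)] using R_pos
    by (intro divide_strict_right_mono zero_less_power)
qed

section \<open>The pivot rule follows the Gray code\<close>

lemma improving_neighbors_vert:
  assumes "B \<subseteq> {1..n}"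
  shows "improving_neighbors cube objective (vert B)
    = {vert (flip k B) | k. k \<in> {1..n} \<and> even (card (B \<inter> {k..n}))}"
proof -
  have improving: "objective \<bullet> vert (flip k B) > objective \<bullet> vert B \<longleftrightarrow> even (card (B \<inter> {k..n}))"
    if k: "k \<in> {1..n}" for k
  proof -
    \<comment> \<open>Both factors are positive, so the parity sign alone decides whether direction
      \<open>k\<close> improves.\<close>
    have "0 < gap (bits B) k * slope B k"
      using gap_pos[OF bits_mem_unit_cube k] slope_bounds[OF k] by simp
    then have "0 < (- 1) ^ card (B \<inter> {k..n}) * (gap (bits B) k * slope B k) \<longleftrightarrow> even (card (B \<inter> {k..n}))"
      by (cases "even (card (B \<inter> {k..n}))") auto
    then have "0 < objective \<bullet> (vert (flip k B) - vert B) \<longleftrightarrow> even (card (B \<inter> {k..n}))"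
      unfolding objective_flip_diff[OF k] mult.assoc .
    then show ?thesis unfolding inner_diff_right diff_gt_0_iff_gt .
  qed
  show ?thesis
  proof (intro subset_antisym subsetI)
    fix u assume "u \<in> improving_neighbors cube objective (vert B)"
    then have u: "u \<in> vertices cube" "closed_segment (vert B) u edge_of cube"
      "objective \<bullet> u > objective \<bullet> vert B"
      by (auto simp: improving_neighbors_def)
    then obtain B' where B': "u = vert B'" "B' \<subseteq> {1..n}" unfolding vertices_cube by blast
    then have "B \<noteq> B'" using u(3) by blast
    then obtain k where "k \<in> {1..n}" "B' = flip k B"
      using closed_segment_face_imp_flip[OF assms B'(2)] u(2) B'(1) unfolding edge_of_def by blast
    then show "u \<in> {vert (flip k B) | k. k \<in> {1..n} \<and> even (card (B \<inter> {k..n}))}"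
      using u(3) B'(1) improving by blast
  next
    fix u assume "u \<in> {vert (flip k B) | k. k \<in> {1..n} \<and> even (card (B \<inter> {k..n}))}"
    then obtain k where k: "k \<in> {1..n}" "even (card (B \<inter> {k..n}))" "u = vert (flip k B)" by blast
    then show "u \<in> improving_neighbors cube objective (vert B)"
      using flip_subset[OF assms k(1)] edge_of_cube_flip[OF assms k(1)] improving[OF k(1)]
      unfolding improving_neighbors_def vertices_cube by blast
  qed
qed

text \<open>A Gray step takes the least improving direction. Every other improving direction is
  larger and has a strictly smaller ratio, so the maximizer is unique.\<close>

lemma pivot_choices_vert:
  assumes \<eta>: "regular_norm \<eta>" and B: "B \<subseteq> {1..n}" and step: "gray_step n B k"
  shows "pivot_choices \<eta> cube objective (vert B) = {vert (flip k B)}"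
proof -
  let ?r = "\<lambda>u. objective \<bullet> (u - vert B) / \<eta> (u - vert B)"
  let ?N = "improving_neighbors cube objective (vert B)"
  have k: "k \<in> {1..n}" "even (card (B \<inter> {k..n}))" "\<And>j. j \<in> {1..<k} \<Longrightarrow> odd (card (B \<inter> {j..n}))"
    using step by (auto simp: gray_step_def)
  have mem: "vert (flip k B) \<in> ?N"
    unfolding improving_neighbors_vert[OF B] using k by blast
  have less: "?r u < ?r (vert (flip k B))" if u: "u \<in> ?N" "u \<noteq> vert (flip k B)" for u
  proof -
    obtain l where l: "l \<in> {1..n}" "even (card (B \<inter> {l..n}))" "u = vert (flip l B)"
      using u(1) unfolding improving_neighbors_vert[OF B] by blast
    have "\<not> l < k" using k(3)[of l] l by auto
    moreover have "l \<noteq> k" using u(2) l(3) by blast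
    ultimately have "k < l" by simp
    then show ?thesis unfolding l(3) using pivot_ratio_less[OF \<eta> k(1) l(1) _ k(2) l(2)] by blast
  qed
  have "is_arg_max ?r (\<lambda>u. u \<in> ?N) u \<longleftrightarrow> u = vert (flip k B)" for u
  proof
    assume "is_arg_max ?r (\<lambda>u. u \<in> ?N) u"
    then show "u = vert (flip k B)"
      unfolding is_arg_max_def using mem less by blast
  next
    assume u: "u = vert (flip k B)"
    have "\<not> ?r y > ?r u" if "y \<in> ?N" for y
      using less[OF that] u by (cases "y = u") (auto dest: less_asym)
    then show "is_arg_max ?r (\<lambda>u. u \<in> ?N) u"
      unfolding is_arg_max_def using mem u by blast
  qed
  then show ?thesis unfolding pivot_choices_def by blast
qed

text \<open>Coordinates increase along the index, so those below \<open>n\<close> contribute at most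
  \<open>2 ^ n\<close> times the coordinate \<open>n - 1\<close>. The upper facet in direction
  \<open>n\<close> then bounds the total by \<open>2 ^ n * 3 ^ n\<close>, attained when all
  coordinates below \<open>n\<close> vanish.\<close>

lemma objective_le_last:
  assumes "x \<in> cube"
  shows "objective \<bullet> x \<le> objective \<bullet> vert {n}"
proof -
  have mono: "coord j \<bullet> x \<le> coord (n - 1) \<bullet> x" if "j \<le> n - 1" for j
    using that
  proof (induction rule: inc_induct)
    case (step m)
    then have "Suc m \<in> {1..n}" by auto
    then have "coord m \<bullet> x \<le> coord (Suc m) \<bullet> x" using assms unfolding mem_cube_iff by (metis diff_Suc_1)
    then show ?case using step by simp
  qed simp
  have split: "objective \<bullet> y = (\<Sum>j=1..<n. 2 ^ j * (coord j \<bullet> y)) + 2 ^ n * (coord n \<bullet> y)" for y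
    using n_pos by (simp add: objective_def inner_sum_left inner_add_left sum.last_plus add.commute
        flip: atLeastLessThanSuc_atLeastAtMost)
  have "(\<Sum>j=1..<n. 2 ^ j * (coord j \<bullet> x)) \<le> (\<Sum>j=1..<n. 2 ^ j * (coord (n - 1) \<bullet> x))"
    by (intro sum_mono mult_left_mono mono) auto
  also have "\<dots> = (2 ^ n - 2) * (coord (n - 1) \<bullet> x)"
    using sum_power2_atLeastLessThan[of 1 n] n_pos by (simp flip: sum_distrib_right)
  also have "\<dots> \<le> 2 ^ n * (coord (n - 1) \<bullet> x)"
    using cube_coord_bounds[OF assms, of "n - 1"] by (intro mult_right_mono) auto
  finally have "objective \<bullet> x \<le> 2 ^ n * (coord (n - 1) \<bullet> x + coord n \<bullet> x)"
    unfolding split by (simp add: algebra_simps)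
  also have "\<dots> \<le> 2 ^ n * 3 ^ n"
    using assms n_pos unfolding mem_cube_iff by (intro mult_left_mono) force+
  also have "\<dots> = objective \<bullet> vert {n}"
  proof -
    have zero: "level (bits {n}) j = 0" if "j < n" for j
      using that by (induction j) auto
    then have "level (bits {n}) n = 3 ^ n"
      using n_pos level_gap[of n "bits {n}"] by (simp add: gap_def)
    then show ?thesis unfolding split using zero by (simp add: vert_def)
  qed
  finally show ?thesis .
qed

lemma maximizing_run_gray:
  assumes "regular_norm \<eta>"
  shows "maximizing_run_through_all_vertices \<eta> cube objective (map vert (gray n))"
proof -
  have last: "last (map vert (gray n)) = vert {n}"
    using n_pos by (simp add: last_map last_gray)
  have inj: "inj_on vert (Pow {1..n})"
    using vert_inject by (auto simp: inj_on_def)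
  have "pivot_choices \<eta> cube objective (map vert (gray n) ! i) = {map vert (gray n) ! Suc i}"
    if i: "Suc i < length (gray n)" for i
  proof -
    obtain k where k: "gray_step n (gray n ! i) k" "gray n ! Suc i = flip k (gray n ! i)"
      using successively_gray[of n] i unfolding successively_conv_nth by blast
    have "gray n ! i \<in> set (gray n)" using i by simp
    then have "gray n ! i \<subseteq> {1..n}" unfolding set_gray by blast
    then show ?thesis using pivot_choices_vert[OF assms _ k(1)] k(2) i by simp
  qed
  \<comment> \<open>All counts at \<open>{n}\<close> are 1, hence odd, so the run stops exactly
    where the Gray code ends.\<close>
  moreover have "improving_neighbors cube objective (vert {n}) = {}"
  proof -
    have "{n} \<inter> {k..n} = {n}" if "k \<in> {1..n}" for k using that by auto
    then show ?thesis using n_pos by (subst improving_neighbors_vert) auto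
  qed
  moreover have "set (map vert (gray n)) = vertices cube"
    by (simp add: set_gray vertices_cube)
  moreover have "distinct (map vert (gray n))"
    using inj by (simp add: distinct_map distinct_gray set_gray)
  moreover have "hd (map vert (gray n)) \<in> set (map vert (gray n))"
    by (intro hd_in_set) simp
  ultimately show ?thesis
    unfolding maximizing_run_through_all_vertices_def pivot_run_def last
    using objective_le_last by simp
qed

end

theorem theorem1p4:
  "\<exists>(C :: (real ^ 'n) set) (c :: real ^ 'n).
     combinatorial_cube C \<and>
     (\<forall>\<eta>. regular_norm \<eta> \<longrightarrow> (\<exists>vs. maximizing_run_through_all_vertices \<eta> C c vs)) \<and>
     (\<forall>p::ereal. 1 \<le> p \<longrightarrow>
        (\<exists>vs. maximizing_run_through_all_vertices (lp_norm p) C c vs \<and>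
              length vs = 2 ^ CARD('n)))"
proof -
  obtain e :: "nat \<Rightarrow> 'n" where e: "bij_betw e {1..CARD('n)} UNIV"
    using ex_bij_betw_nat_finite_1[OF finite_class.finite_UNIV] by blast
  interpret enumerated_index e "CARD('n)"
    by unfold_locales (rule e)
  \<comment> \<open>The same list is the run for every regular norm, so its length settles all
    \<open>p\<close> at once.\<close>
  have "length (map vert (gray CARD('n))) = 2 ^ CARD('n)"
    by (simp add: length_gray)
  then show ?thesis
    using combinatorial_cube_cube maximizing_run_gray regular_norm_lp_norm by blast
qed

end
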